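(* Let $1 < p \leq q < \infty$ and let $\psi_1, \psi_2, \varphi_1, \varphi_2$ be entire functions on $\mathbb{C}$ with $\psi_1 \not\equiv 0$, $\psi_2 \not\equiv 0$ and $\varphi_1 \not\equiv \varphi_2$. Suppose that $W_{\psi_1,\varphi_1} - W_{\psi_2,\varphi_2}: \mathcal{F}^p \to \mathcal{F}^q$ is bounded, and that $\varphi_1(z) = a_1 z + b_1$, $\varphi_2(z) = a_2 z + b_2$ with $a_1,a_2,b_1,b_2\in\mathbb{C}$, $0 < |a_1| \leq 1$ and $0 < |a_2| \leq 1$. Then $$\alpha_{\varphi_1, \varphi_2} \limsup_{|z|\to\infty} \left( m_z(\psi_1,\varphi_1) + m_z(\psi_2,\varphi_2) \right) \leq \|W_{\psi_1,\varphi_1} - W_{\psi_2,\varphi_2}\|_e$$ and $$\|W_{\psi_1,\varphi_1} - W_{\psi_2,\varphi_2}\|_e \leq 2\left( \frac{q}{p|a_1|^2}\right)^{\frac{1}{q}} \limsup_{|z| \to \infty} m_z(\psi_1, \varphi_1) + 2\left( \frac{q}{p|a_2|^2}\right)^{\frac{1}{q}} \limsup_{|z| \to \infty} m_z(\psi_2, \varphi_2),$$ where $$\alpha_{\varphi_1, \varphi_2} := \begin{cases} \frac{1}{2}, & \text{if } a_1 \neq a_2, \\ \rho(b_1, b_2), & \text{if } a_1 = a_2. \end{cases}$$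
   Context: For $p \in (0,\infty)$, the Fock space $\mathcal{F}^p$ is the space of entire functions $f$ on $\mathbb{C}$ with $$\|f\|_p := \left( \frac{p}{2\pi} \int_{\mathbb{C}} |f(z)|^p e^{-\frac{p|z|^2}{2}}\, dA(z) \right)^{1/p} < \infty,$$ where $dA$ is Lebesgue measure on $\mathbb{C}$; for $p\ge 1$ it is a Banach space. For entire functions $\psi, \varphi$, the weighted composition operator $W_{\psi,\varphi}$ is defined on entire functions by $W_{\psi,\varphi} f = \psi \cdot (f \circ \varphi)$. Boundedness of an operator from $\mathcal{F}^p$ to $\mathcal{F}^q$ includes that it maps $\mathcal{F}^p$ into $\mathcal{F}^q$. Put $m_z(\psi,\varphi) := |\psi(z)|\, e^{\frac{|\varphi(z)|^2 - |z|^2}{2}}$ for $z \in \mathbb{C}$, and $\rho(w_1,w_2) := \dfrac{|w_1-w_2|^2}{2(2+|w_1-w_2|^2)}$ for $w_1,w_2 \in \mathbb{C}$. For a bounded linear operator $L: \mathcal{F}^p \to \mathcal{F}^q$, the essential norm is $\|L\|_e := \inf\{\|L-K\| : K \text{ is a compact operator from } \mathcal{F}^p \text{ into } \mathcal{F}^q\}$, where $\|\cdot\|$ is the operator norm. (Boundedness of $W_{\psi_1,\varphi_1} - W_{\psi_2,\varphi_2}$ already forces $\varphi_j(z)=a_jz+b_j$ with $|a_j|\le 1$; the additional assumption is that $a_1\ne 0$ and $a_2 \neq 0$.) *)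

theory Defs
  imports "HOL-Complex_Analysis.Complex_Analysis"
begin

definition fock_density :: "real \<Rightarrow> (complex \<Rightarrow> complex) \<Rightarrow> complex \<Rightarrow> real" where
  "fock_density p f z = norm (f z) powr p * exp (- (p * (norm z)\<^sup>2 / 2))"

definition fock_space :: "real \<Rightarrow> (complex \<Rightarrow> complex) set" where
  "fock_space p = {f. f holomorphic_on UNIV \<and> integrable lborel (fock_density p f)}"

definition fock_norm :: "real \<Rightarrow> (complex \<Rightarrow> complex) \<Rightarrow> real" where
  "fock_norm p f = (p / (2 * pi) * (LINT z|lborel. fock_density p f z)) powr (1 / p)"

text \<open>Operators are total maps on functions; only their values on \<open>fock_space p\<close> matter below.\<close>

type_synonym fun_op = "(complex \<Rightarrow> complex) \<Rightarrow> (complex \<Rightarrow> complex)"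

definition weighted_comp :: "(complex \<Rightarrow> complex) \<Rightarrow> (complex \<Rightarrow> complex) \<Rightarrow> fun_op" where
  "weighted_comp \<psi> \<phi> f = (\<lambda>z. \<psi> z * f (\<phi> z))"

definition op_diff :: "fun_op \<Rightarrow> fun_op \<Rightarrow> fun_op" where
  "op_diff L K f = (\<lambda>z. L f z - K f z)"

definition fock_linear :: "real \<Rightarrow> real \<Rightarrow> fun_op \<Rightarrow> bool" where
  "fock_linear p q L \<longleftrightarrow>
     (\<forall>f\<in>fock_space p. L f \<in> fock_space q) \<and>
     (\<forall>f\<in>fock_space p. \<forall>g\<in>fock_space p. L (\<lambda>z. f z + g z) = (\<lambda>z. L f z + L g z)) \<and>
     (\<forall>c. \<forall>f\<in>fock_space p. L (\<lambda>z. c * f z) = (\<lambda>z. c * L f z))"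

definition fock_bounded_linear :: "real \<Rightarrow> real \<Rightarrow> fun_op \<Rightarrow> bool" where
  "fock_bounded_linear p q L \<longleftrightarrow>
     fock_linear p q L \<and> (\<exists>C. \<forall>f\<in>fock_space p. fock_norm q (L f) \<le> C * fock_norm p f)"

definition fock_compact :: "real \<Rightarrow> real \<Rightarrow> fun_op \<Rightarrow> bool" where
  "fock_compact p q K \<longleftrightarrow>
     fock_bounded_linear p q K \<and>
     (\<forall>f :: nat \<Rightarrow> complex \<Rightarrow> complex.
        (\<forall>n. f n \<in> fock_space p) \<and> (\<exists>C. \<forall>n. fock_norm p (f n) \<le> C) \<longrightarrow>
        (\<exists>r g. strict_mono r \<and> g \<in> fock_space q \<and>
           (\<lambda>n. fock_norm q (\<lambda>z. K (f (r n)) z - g z)) \<longlonglongrightarrow> 0))"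

text \<open>Norms of operators take values in \<open>ereal\<close>, so that \<open>SUP\<close> and \<open>INF\<close> need no
  boundedness side conditions.\<close>

definition fock_op_norm :: "real \<Rightarrow> real \<Rightarrow> fun_op \<Rightarrow> ereal" where
  "fock_op_norm p q L =
     (SUP f\<in>{f \<in> fock_space p. fock_norm p f \<le> 1}. ereal (fock_norm q (L f)))"

definition fock_ess_norm :: "real \<Rightarrow> real \<Rightarrow> fun_op \<Rightarrow> ereal" where
  "fock_ess_norm p q L = (INF K\<in>{K. fock_compact p q K}. fock_op_norm p q (op_diff L K))"

definition m_fun :: "(complex \<Rightarrow> complex) \<Rightarrow> (complex \<Rightarrow> complex) \<Rightarrow> complex \<Rightarrow> real" where
  "m_fun \<psi> \<phi> z = norm (\<psi> z) * exp (((norm (\<phi> z))\<^sup>2 - (norm z)\<^sup>2) / 2)"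

definition rho :: "complex \<Rightarrow> complex \<Rightarrow> real" where
  "rho w1 w2 = (norm (w1 - w2))\<^sup>2 / (2 * (2 + (norm (w1 - w2))\<^sup>2))"

text \<open>The constant for the symbols \<open>a1 * z + b1\<close> and \<open>a2 * z + b2\<close>.\<close>

definition alpha :: "complex \<Rightarrow> complex \<Rightarrow> complex \<Rightarrow> complex \<Rightarrow> real" where
  "alpha a1 b1 a2 b2 = (if a1 \<noteq> a2 then 1 / 2 else rho b1 b2)"

end

theory Submission
  imports Defs "HOL-Probability.Distributions"
begin

text \<open>The normalised kernels \<open>k w z = exp (cnj w * z - (norm w)\<^sup>2 / 2)\<close> satisfy
  \<open>norm (k w z) * exp (- (norm z)\<^sup>2 / 2) = exp (- (norm (z - w))\<^sup>2 / 2)\<close> and have norm one, and every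
  compact operator sends \<open>k w\<close> to zero as \<open>w\<close> tends to infinity. For the lower bound, the image of
  \<open>k (\<phi>1 z)\<close>, respectively \<open>k (\<phi>2 z)\<close>, is evaluated at \<open>z\<close>: adding the two estimates bounds
  \<open>(1 - exp (- (norm (\<phi>1 z - \<phi>2 z))\<^sup>2 / 2)) * (m1 + m2)\<close> by twice the norm of \<open>L - K\<close>, up to a
  null function. For the upper bound, \<open>K\<close> is the composition of \<open>L\<close> with the dilation \<open>f \<mapsto> f (r z)\<close>,
  which is a compact contraction, so that \<open>f - f (r z)\<close> has norm at most 2 and is small on compact
  sets for \<open>r\<close> close to 1; outside a large disc \<open>m1\<close> and \<open>m2\<close> are controlled by their upper limits.\<close>

section \<open>Lebesgue measure on the complex plane\<close>

text \<open>Everything runs on the weighted modulus |f(z)| exp(-|z|^2/2): a weighted composition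
  operator carries it from \<open>\<phi> z\<close> to \<open>z\<close> with the factor
  \<open>m_fun \<psi> \<phi> z\<close>. Origin of the constants: with x = |\<phi>1 z - \<phi>2
  z|^2/2, the factor 1 - exp(-x) tends to 1 if the slopes differ and is at least x/(1+x) if they
  agree; each of the two added estimates costs one operator norm, and halving gives 1/2 and
  \<open>rho\<close>. In the upper bound, 1/|a|^2 is the Jacobian of the symbol, q/p the quotient of
  the normalising factors of the two norms, and 2 the bound for the norm of f - f(r z). Nonzero
  slopes serve twice: they send \<open>\<phi>1 z\<close> and \<open>\<phi>2 z\<close> to infinity
  with \<open>z\<close>, where compact operators make the kernels vanish, and they permit the change
  of variables. The condition p > 1 enters through N^(1/p - 1) tending to 0. The bound of the
  weighted modulus by the norm, used throughout, itself comes from the contractivity of dilations: r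
  = 0 settles the origin, and an isometric translation moves any point there.\<close>

lemma borel_measurable_Complex [measurable]:
  "(\<lambda>(x, y). Complex x y) \<in> borel_measurable (lborel \<Otimes>\<^sub>M lborel)"
  unfolding lborel_prod by (auto intro!: borel_measurable_continuous_onI continuous_intros simp: case_prod_unfold)

text \<open>Lebesgue measure is determined by its values on boxes, and a box of complex numbers is a
  product of two intervals. This makes Fubini's theorem and one-dimensional substitutions available
  on the plane.\<close>

lemma lborel_complex:
  "(lborel :: complex measure) = distr (lborel \<Otimes>\<^sub>M lborel) borel (\<lambda>(x, y). Complex x y)"
proof (rule lborel_eqI)
  fix l u :: complex
  assume lu: "\<And>b. b \<in> Basis \<Longrightarrow> l \<bullet> b \<le> u \<bullet> b"
  have le: "Re l \<le> Re u" "Im l \<le> Im u"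
    using lu[of 1] lu[of \<i>] by (auto simp: Basis_complex_def)
  have "(\<lambda>(x, y). Complex x y) -` box l u = box (Re l) (Re u) \<times> box (Im l) (Im u)"
    by (auto simp: in_box_complex_iff)
  then have "emeasure (distr (lborel \<Otimes>\<^sub>M lborel) borel (\<lambda>(x, y). Complex x y)) (box l u)
      = emeasure (lborel \<Otimes>\<^sub>M lborel) (box (Re l) (Re u) \<times> box (Im l) (Im u))"
    by (subst emeasure_distr) (auto simp: space_pair_measure)
  also have "\<dots> = ennreal (prod ((\<bullet>) (u - l)) Basis)"
    using le by (subst lborel.emeasure_pair_measure_Times)
      (auto simp: Basis_complex_def mult.commute simp flip: ennreal_mult)
  finally show "emeasure (distr (lborel \<Otimes>\<^sub>M lborel) borel (\<lambda>(x, y). Complex x y)) (box l u)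
      = ennreal (prod ((\<bullet>) (u - l)) Basis)" .
qed simp

lemma borel_measurable_Complex' [measurable]:
  assumes [measurable]: "f \<in> borel_measurable M" "g \<in> borel_measurable M"
  shows "(\<lambda>x. Complex (f x) (g x)) \<in> borel_measurable M"
  using measurable_compose[OF measurable_Pair borel_measurable_Complex, of f M g] assms
  by (simp add: measurable_lborel1)

lemma nn_integral_complex:
  assumes [measurable]: "F \<in> borel_measurable (borel :: complex measure)"
  shows "(\<integral>\<^sup>+z. F z \<partial>lborel) = (\<integral>\<^sup>+x. \<integral>\<^sup>+y. F (Complex x y) \<partial>lborel \<partial>lborel)"
    and "(\<integral>\<^sup>+z. F z \<partial>lborel) = (\<integral>\<^sup>+y. \<integral>\<^sup>+x. F (Complex x y) \<partial>lborel \<partial>lborel)"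
proof -
  have eq: "(\<integral>\<^sup>+z. F z \<partial>lborel) = (\<integral>\<^sup>+(x, y). F (Complex x y) \<partial>(lborel \<Otimes>\<^sub>M lborel))"
    by (subst lborel_complex, subst nn_integral_distr) (auto simp: case_prod_unfold)
  show "(\<integral>\<^sup>+z. F z \<partial>lborel) = (\<integral>\<^sup>+x. \<integral>\<^sup>+y. F (Complex x y) \<partial>lborel \<partial>lborel)"
    unfolding eq by (subst lborel.nn_integral_fst[symmetric]) (auto simp: case_prod_unfold)
  show "(\<integral>\<^sup>+z. F z \<partial>lborel) = (\<integral>\<^sup>+y. \<integral>\<^sup>+x. F (Complex x y) \<partial>lborel \<partial>lborel)"
    unfolding eq by (subst lborel_pair.nn_integral_snd[symmetric]) (auto simp: case_prod_unfold)
qed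

text \<open>Multiplication by u + iv is a real matrix of determinant |a|^2. It factors into two maps
  that each change one coordinate only, so two one-dimensional affine substitutions with a Fubini
  exchange in between suffice. The factorisation divides by \<open>u\<close>; for u = 0 the matrix
  merely swaps and scales the coordinates.\<close>

lemma nn_integral_complex_mult:
  fixes a :: complex
  assumes [measurable]: "F \<in> borel_measurable (borel :: complex measure)" and "a \<noteq> 0"
  shows "(\<integral>\<^sup>+z. F z \<partial>lborel) = ennreal ((norm a)\<^sup>2) * (\<integral>\<^sup>+z. F (a * z) \<partial>lborel)"
proof -
  define u v where "u = Re a" and "v = Im a"
  have a: "a = Complex u v" by (simp add: u_def v_def)
  have n: "(norm a)\<^sup>2 = u\<^sup>2 + v\<^sup>2" by (simp add: a cmod_power2)
  have n0: "u\<^sup>2 + v\<^sup>2 \<noteq> 0" using \<open>a \<noteq> 0\<close> by (simp add: sum_power2_eq_zero_iff u_def v_def complex_eq_iff)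
  have m: "a * Complex x y = Complex (u * x - v * y) (v * x + u * y)" for x y
    by (simp add: a complex_eq_iff)
  have Fa: "(\<lambda>z. F (a * z)) \<in> borel_measurable borel" by measurable
  show ?thesis
  proof (cases "u = 0")
    case True
    then have v: "v \<noteq> 0" using n0 by simp
    have "(\<integral>\<^sup>+z. F z \<partial>lborel) = (\<integral>\<^sup>+x. \<integral>\<^sup>+y. F (Complex x y) \<partial>lborel \<partial>lborel)"
      by (rule nn_integral_complex) simp
    also have "\<dots> = \<bar>-v\<bar> * (\<integral>\<^sup>+x. \<integral>\<^sup>+y. F (Complex (0 + (-v) * x) y) \<partial>lborel \<partial>lborel)"
      using v by (intro nn_integral_real_affine) auto
    also have "\<dots> = \<bar>-v\<bar> * (\<integral>\<^sup>+x. \<bar>v\<bar> * (\<integral>\<^sup>+y. F (Complex (0 + (-v) * x) (0 + v * y)) \<partial>lborel) \<partial>lborel)"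
      using v by (subst nn_integral_real_affine[of _ v 0]) auto
    also have "\<dots> = ennreal \<bar>-v\<bar> * ennreal \<bar>v\<bar> * (\<integral>\<^sup>+x. (\<integral>\<^sup>+y. F (a * Complex y x) \<partial>lborel) \<partial>lborel)"
      using True by (subst nn_integral_cmult) (auto simp: m mult.assoc)
    also have "(\<integral>\<^sup>+x. (\<integral>\<^sup>+y. F (a * Complex y x) \<partial>lborel) \<partial>lborel) = (\<integral>\<^sup>+z. F (a * z) \<partial>lborel)"
      by (rule nn_integral_complex(2)[OF Fa, symmetric])
    moreover have "ennreal \<bar>-v\<bar> * ennreal \<bar>v\<bar> = ennreal ((norm a)\<^sup>2)"
      unfolding n using True by (simp add: power2_eq_square flip: ennreal_mult)
    ultimately show ?thesis by simp
  next
    case False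
    \<comment> \<open>\<open>k\<close> is the second pivot of the elimination: v x + u y equals v/u
      times the new real part u x - v y, plus k y. The product of the pivots is k u = |a|^2.\<close>
    define k where "k = (u\<^sup>2 + v\<^sup>2) / u"
    have k: "k \<noteq> 0" using n0 False by (simp add: k_def)
    have e: "Complex (- v * y + u * x) (v / u * (- v * y + u * x) + k * y) = a * Complex x y" for x y
      using False by (simp add: m k_def field_simps power2_eq_square)
    have "(\<integral>\<^sup>+z. F z \<partial>lborel) = (\<integral>\<^sup>+x. \<integral>\<^sup>+y. F (Complex x y) \<partial>lborel \<partial>lborel)"
      by (rule nn_integral_complex) simp
    also have "\<dots> = (\<integral>\<^sup>+x. \<bar>k\<bar> * (\<integral>\<^sup>+y. F (Complex x (v / u * x + k * y)) \<partial>lborel) \<partial>lborel)"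
      using k by (intro nn_integral_cong nn_integral_real_affine) auto
    also have "\<dots> = \<bar>k\<bar> * (\<integral>\<^sup>+x. (\<integral>\<^sup>+y. F (Complex x (v / u * x + k * y)) \<partial>lborel) \<partial>lborel)"
      by (rule nn_integral_cmult) simp
    also have "(\<integral>\<^sup>+x. (\<integral>\<^sup>+y. F (Complex x (v / u * x + k * y)) \<partial>lborel) \<partial>lborel)
       = (\<integral>\<^sup>+y. (\<integral>\<^sup>+x. F (Complex x (v / u * x + k * y)) \<partial>lborel) \<partial>lborel)"
      by (rule lborel_pair.Fubini') simp
    also have "\<dots> = (\<integral>\<^sup>+y. \<bar>u\<bar> * (\<integral>\<^sup>+x. F (Complex (- v * y + u * x) (v / u * (- v * y + u * x) + k * y)) \<partial>lborel) \<partial>lborel)"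
      using False by (intro nn_integral_cong nn_integral_real_affine) auto
    also have "\<dots> = \<bar>u\<bar> * (\<integral>\<^sup>+y. (\<integral>\<^sup>+x. F (Complex (- v * y + u * x) (v / u * (- v * y + u * x) + k * y)) \<partial>lborel) \<partial>lborel)"
      by (rule nn_integral_cmult) simp
    also have "(\<integral>\<^sup>+y. (\<integral>\<^sup>+x. F (Complex (- v * y + u * x) (v / u * (- v * y + u * x) + k * y)) \<partial>lborel) \<partial>lborel)
       = (\<integral>\<^sup>+y. (\<integral>\<^sup>+x. F (a * Complex x y) \<partial>lborel) \<partial>lborel)"
      by (simp only: e)
    also have "\<dots> = (\<integral>\<^sup>+z. F (a * z) \<partial>lborel)"
      by (rule nn_integral_complex(2)[OF Fa, symmetric])
    finally have "(\<integral>\<^sup>+z. F z \<partial>lborel) = ennreal (\<bar>k\<bar> * \<bar>u\<bar>) * (\<integral>\<^sup>+z. F (a * z) \<partial>lborel)"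
      by (simp add: ennreal_mult mult.assoc)
    also have "\<bar>k\<bar> * \<bar>u\<bar> = (norm a)\<^sup>2" using False by (simp add: n k_def flip: abs_mult)
    finally show ?thesis .
  qed
qed

lemma nn_integral_lborel_plus:
  fixes b :: complex
  assumes [measurable]: "F \<in> borel_measurable (borel :: complex measure)"
  shows "(\<integral>\<^sup>+z. F (z + b) \<partial>lborel) = (\<integral>\<^sup>+z. F z \<partial>lborel)"
proof -
  have "(\<integral>\<^sup>+z. F z \<partial>lborel) = (\<integral>\<^sup>+z. F z \<partial>(distr lborel borel ((+) b)))"
    by (simp add: lborel_distr_plus)
  also have "\<dots> = (\<integral>\<^sup>+z. F (z + b) \<partial>lborel)"
    by (subst nn_integral_distr) (auto simp: add.commute)
  finally show ?thesis ..
qed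

lemma nn_integral_complex_affine:
  fixes a b :: complex
  assumes [measurable]: "F \<in> borel_measurable (borel :: complex measure)" and "a \<noteq> 0"
  shows "(\<integral>\<^sup>+z. F (a * z + b) \<partial>lborel) = ennreal (1 / (norm a)\<^sup>2) * (\<integral>\<^sup>+z. F z \<partial>lborel)"
proof -
  have "(\<integral>\<^sup>+z. F z \<partial>lborel) = (\<integral>\<^sup>+z. F (z + b) \<partial>lborel)"
    by (rule nn_integral_lborel_plus[symmetric]) simp
  also have "\<dots> = ennreal ((norm a)\<^sup>2) * (\<integral>\<^sup>+z. F (a * z + b) \<partial>lborel)"
    using \<open>a \<noteq> 0\<close> by (intro nn_integral_complex_mult) auto
  finally show ?thesis
    using \<open>a \<noteq> 0\<close> by (simp flip: mult.assoc ennreal_mult)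
qed

text \<open>A rescaling of the fact that the standard normal density has total mass one; the scale
  \<open>s\<close> is chosen with s^2/2 = c.\<close>

lemma nn_integral_gaussian_real:
  assumes "c > 0"
  shows "(\<integral>\<^sup>+x. ennreal (exp (- (c * x\<^sup>2))) \<partial>lborel) = ennreal (sqrt (pi / c))"
proof -
  define s where "s = sqrt (2 * c)"
  have s: "s > 0" "s\<^sup>2 = 2 * c" using assms by (auto simp: s_def)
  have "ennreal 1 = (\<integral>\<^sup>+x. ennreal (std_normal_density x) \<partial>lborel)"
    using integral_std_normal_moment_even[of 0] integrable_std_normal_moment[of 0]
    by (subst nn_integral_eq_integral) auto
  also have "\<dots> = \<bar>s\<bar> * (\<integral>\<^sup>+x. ennreal (std_normal_density (0 + s * x)) \<partial>lborel)"
    using s by (intro nn_integral_real_affine) auto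
  also have "(\<lambda>x. ennreal (std_normal_density (0 + s * x))) = (\<lambda>x. ennreal (1 / sqrt (2 * pi)) * ennreal (exp (- (c * x\<^sup>2))))"
    by (simp add: std_normal_density_def power_mult_distrib s fun_eq_iff flip: ennreal_mult)
  also have "(\<integral>\<^sup>+x. ennreal (1 / sqrt (2 * pi)) * ennreal (exp (- (c * x\<^sup>2))) \<partial>lborel)
     = ennreal (1 / sqrt (2 * pi)) * (\<integral>\<^sup>+x. ennreal (exp (- (c * x\<^sup>2))) \<partial>lborel)"
    by (rule nn_integral_cmult) simp
  finally have "ennreal 1 = ennreal \<bar>s\<bar> * ennreal (1 / sqrt (2 * pi)) * (\<integral>\<^sup>+x. ennreal (exp (- (c * x\<^sup>2))) \<partial>lborel)"
    by (simp only: mult.assoc)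
  then have "ennreal (sqrt (2 * pi) / s) * ennreal 1
      = ennreal (sqrt (2 * pi) / s) * (ennreal \<bar>s\<bar> * ennreal (1 / sqrt (2 * pi)) * (\<integral>\<^sup>+x. ennreal (exp (- (c * x\<^sup>2))) \<partial>lborel))"
    by (rule arg_cong)
  also have "\<dots> = (\<integral>\<^sup>+x. ennreal (exp (- (c * x\<^sup>2))) \<partial>lborel)"
    using s by (simp flip: mult.assoc ennreal_mult)
  finally show ?thesis
    by (simp add: s_def real_sqrt_divide real_sqrt_mult)
qed

lemma nn_integral_gaussian_complex:
  assumes "c > 0"
  shows "(\<integral>\<^sup>+z. ennreal (exp (- (c * (norm z)\<^sup>2))) \<partial>(lborel :: complex measure)) = ennreal (pi / c)"
proof -
  have "(\<integral>\<^sup>+z. ennreal (exp (- (c * (norm z)\<^sup>2))) \<partial>(lborel :: complex measure))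
     = (\<integral>\<^sup>+x. \<integral>\<^sup>+y. ennreal (exp (- (c * x\<^sup>2))) * ennreal (exp (- (c * y\<^sup>2))) \<partial>lborel \<partial>lborel)"
    by (subst nn_integral_complex) (auto simp: cmod_power2 algebra_simps simp flip: ennreal_mult exp_add)
  also have "\<dots> = (\<integral>\<^sup>+x. ennreal (exp (- (c * x\<^sup>2))) * ennreal (sqrt (pi / c)) \<partial>lborel)"
    using nn_integral_gaussian_real[OF assms] by (subst nn_integral_cmult) auto
  also have "\<dots> = ennreal (sqrt (pi / c)) * ennreal (sqrt (pi / c))"
    using nn_integral_gaussian_real[OF assms] by (subst nn_integral_multc) auto
  also have "\<dots> = ennreal (pi / c)" using assms by (simp flip: ennreal_mult)
  finally show ?thesis .
qed

section \<open>Convexity and Poisson averages\<close>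

lemma powr_above_tangent:
  fixes x y p :: real
  assumes "p \<ge> 1" "x \<ge> 0" "y \<ge> 0"
  shows "y powr p + p * y powr (p - 1) * (x - y) \<le> x powr p"
\<comment> \<open>The tangent criterion is applied on the open half-line, so the boundary is
  separate. Since \<open>0 powr 0 = 0\<close>, the left side vanishes at y = 0 even for p =
  1.\<close>
proof (cases "x = 0 \<or> y = 0")
  case True
  have "y powr p = y powr (p - 1) * y" if "y \<noteq> 0"
    using that assms powr_add[of y "p - 1" 1] by simp
  then have "p * y powr (p - 1) * y \<ge> y powr p" 
    using assms by (cases "y = 0") (auto simp: mult_right_mono)
  then show ?thesis using True assms by (auto simp: algebra_simps)
next
  case False
  then have "p * y powr (p - 1) * (x - y) \<le> x powr p - y powr p"
    using assms
    by (intro convex_on_imp_above_tangent[where A = "{0<..}" and f = "\<lambda>x. x powr p"] powr_convex)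
       (auto intro!: derivative_eq_intros simp: interior_open)
  then show ?thesis by simp
qed

text \<open>Both tangent inequalities are taken at the mean \<open>m\<close>; in their weighted sum
  the linear terms cancel.\<close>

lemma powr_convex_combination:
  fixes x y p s t :: real
  assumes "p \<ge> 1" "x \<ge> 0" "y \<ge> 0" "s \<ge> 0" "t \<ge> 0" "s + t = 1"
  shows "(s * x + t * y) powr p \<le> s * x powr p + t * y powr p"
proof -
  define m where "m = s * x + t * y"
  have m: "m \<ge> 0" using assms by (simp add: m_def)
  have "s * (m powr p + p * m powr (p - 1) * (x - m)) + t * (m powr p + p * m powr (p - 1) * (y - m))
     \<le> s * x powr p + t * y powr p"
    using assms m by (intro add_mono mult_left_mono powr_above_tangent)
  moreover have "s * (m powr p + p * m powr (p - 1) * (x - m)) + t * (m powr p + p * m powr (p - 1) * (y - m))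
     = (s + t) * m powr p + p * m powr (p - 1) * (s * x + t * y - (s + t) * m)"
    by (simp add: algebra_simps)
  ultimately show ?thesis using assms by (simp add: m_def)
qed

section \<open>Fock norms through nonnegative integrals, and the triangle inequality\<close>

definition fock_nn :: "real \<Rightarrow> (complex \<Rightarrow> complex) \<Rightarrow> ennreal" where
  "fock_nn p f = (\<integral>\<^sup>+z. ennreal (fock_density p f z) \<partial>lborel)"

lemma fock_density_nonneg [simp]: "0 \<le> fock_density p f z"
  by (simp add: fock_density_def)

lemma fock_density_eq: "fock_density p f z = (norm (f z) * exp (- ((norm z)\<^sup>2 / 2))) powr p"
  by (simp add: fock_density_def powr_mult exp_powr_real algebra_simps)

lemma borel_measurable_entire:
  fixes f :: "complex \<Rightarrow> complex"
  assumes "f holomorphic_on UNIV"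
  shows "f \<in> borel_measurable borel"
  using assms by (intro borel_measurable_continuous_onI holomorphic_on_imp_continuous_on)

lemma borel_measurable_fock_density:
  assumes "f holomorphic_on UNIV"
  shows "fock_density p f \<in> borel_measurable borel"
proof -
  note borel_measurable_entire[OF assms, measurable]
  show ?thesis unfolding fock_density_def by measurable
qed

lemma fock_nn_eq_norm:
  assumes "f \<in> fock_space p" "p > 0"
  shows "fock_nn p f = ennreal (2 * pi / p * fock_norm p f powr p)"
proof -
  have i: "integrable lborel (fock_density p f)" using assms by (simp add: fock_space_def)
  define I where "I = (LINT z|lborel. fock_density p f z)"
  have I: "I \<ge> 0" unfolding I_def by (rule integral_nonneg_AE) auto
  have "fock_nn p f = ennreal I"
    unfolding fock_nn_def I_def by (rule nn_integral_eq_integral[OF i]) auto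
  also have "I = 2 * pi / p * fock_norm p f powr p"
    using I assms by (simp add: fock_norm_def powr_powr flip: I_def)
  finally show ?thesis .
qed

text \<open>The common exit from computations with \<open>fock_nn\<close>: those need measurability
  only, and one bound then yields membership and the norm estimate together.\<close>

lemma fock_space_normI:
  assumes "f holomorphic_on UNIV" "p > 0" "A \<ge> 0"
    and "fock_nn p f \<le> ennreal (2 * pi / p * A powr p)"
  shows "f \<in> fock_space p" "fock_norm p f \<le> A"
proof -
  note m = borel_measurable_fock_density[OF assms(1), of p]
  have i: "integrable lborel (fock_density p f)"
  proof (rule integrableI_bounded)
    show "fock_density p f \<in> borel_measurable lborel" using m by simp
    show "(\<integral>\<^sup>+x. ennreal (norm (fock_density p f x)) \<partial>lborel) < \<infinity>"
      using assms(4) by (auto simp: fock_nn_def intro: le_less_trans)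
  qed
  then show f: "f \<in> fock_space p" using assms by (simp add: fock_space_def)
  have "2 * pi / p * fock_norm p f powr p \<le> 2 * pi / p * A powr p"
    using assms fock_nn_eq_norm[OF f \<open>p > 0\<close>] by simp
  then have le: "fock_norm p f powr p \<le> A powr p"
    using assms by (simp add: divide_right_mono mult_le_cancel_left_pos divide_simps)
  show "fock_norm p f \<le> A"
  proof (rule ccontr)
    assume "\<not> ?thesis"
    then have "A powr p < fock_norm p f powr p" using assms by (intro powr_less_mono2) auto
    with le show False by simp
  qed
qed

lemma fock_norm_nonneg [simp]: "0 \<le> fock_norm p f"
  by (simp add: fock_norm_def)

lemma fock_spaceD: "f \<in> fock_space p \<Longrightarrow> f holomorphic_on UNIV"
  by (simp add: fock_space_def)

lemma fock_norm_cong_nn: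
  assumes "f \<in> fock_space p" "g holomorphic_on UNIV" "p > 0" "fock_nn p g = fock_nn p f"
  shows "g \<in> fock_space p" "fock_norm p g = fock_norm p f"
proof -
  show g: "g \<in> fock_space p"
    by (rule fock_space_normI(1)[of g p "fock_norm p f"]) (use assms fock_nn_eq_norm[of f p] in auto)
  have "fock_norm p g \<le> fock_norm p f"
    by (rule fock_space_normI(2)[of g p "fock_norm p f"]) (use assms fock_nn_eq_norm[of f p] in auto)
  moreover have "fock_norm p f \<le> fock_norm p g"
    by (rule fock_space_normI(2)) (use assms fock_spaceD fock_nn_eq_norm[OF g] in auto)
  ultimately show "fock_norm p g = fock_norm p f" by simp
qed

text \<open>Rescaling \<open>f\<close> and \<open>g\<close> to norm one reduces this to the convexity of \<open>x powr p\<close>.\<close>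

lemma fock_norm_triangle:
  assumes f: "f \<in> fock_space p" and g: "g \<in> fock_space p" and h: "h holomorphic_on UNIV"
    and p: "p \<ge> 1" and le: "\<And>z. norm (h z) \<le> norm (f z) + norm (g z)"
  shows "h \<in> fock_space p" "fock_norm p h \<le> fock_norm p f + fock_norm p g"
proof -
  \<comment> \<open>\<open>A\<close> and \<open>B\<close> strictly exceed the norms so that dividing
    by them is legitimate even when a norm is zero; the excess is removed at the end by letting it
    tend to 0.\<close>
  have key: "fock_nn p h \<le> ennreal (2 * pi / p * (A + B) powr p)"
    if A: "A > fock_norm p f" and B: "B > fock_norm p g" for A B
  proof -
    note [measurable] = borel_measurable_fock_density[OF fock_spaceD[OF f]]
      borel_measurable_fock_density[OF fock_spaceD[OF g]]
    have "0 \<le> fock_norm p f" "0 \<le> fock_norm p g" by simp_all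
    with A B have pos: "A > 0" "B > 0" by linarith+
    \<comment> \<open>\<open>c\<close> and \<open>d\<close> are what convexity leaves when u/A and
      v/B are averaged with the weights A/(A+B) and B/(A+B).\<close>
    define c where "c = (A + B) powr p * (A / (A + B)) / A powr p"
    define d where "d = (A + B) powr p * (B / (A + B)) / B powr p"
    have cd: "c \<ge> 0" "d \<ge> 0" using pos by (auto simp: c_def d_def)
    have pt: "fock_density p h z \<le> c * fock_density p f z + d * fock_density p g z" for z
    proof -
      define e where "e = exp (- ((norm z)\<^sup>2 / 2))"
      define u v where "u = norm (f z) * e" and "v = norm (g z) * e"
      have uv: "u \<ge> 0" "v \<ge> 0" by (auto simp: u_def v_def e_def)
      have "fock_density p h z \<le> (u + v) powr p"
        unfolding fock_density_eq using le[of z] p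
        by (intro powr_mono2) (auto simp: u_def v_def e_def simp flip: distrib_right)
      also have "u + v = (A + B) * (A / (A + B) * (u / A) + B / (A + B) * (v / B))"
        using pos by (simp flip: add_divide_distrib)
      also have "\<dots> powr p = (A + B) powr p * (A / (A + B) * (u / A) + B / (A + B) * (v / B)) powr p"
        by (rule powr_mult)
      also have "\<dots> \<le> (A + B) powr p * (A / (A + B) * (u / A) powr p + B / (A + B) * (v / B) powr p)"
        using pos uv p by (intro mult_left_mono powr_convex_combination) (auto simp flip: add_divide_distrib)
      also have "\<dots> = c * u powr p + d * v powr p"
        by (simp add: c_def d_def powr_divide algebra_simps)
      finally show ?thesis by (simp add: fock_density_eq u_def v_def e_def)
    qed
    have "fock_nn p h \<le> (\<integral>\<^sup>+z. ennreal c * ennreal (fock_density p f z) + ennreal d * ennreal (fock_density p g z) \<partial>lborel)"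
      unfolding fock_nn_def using pt cd
      by (intro nn_integral_mono) (simp flip: ennreal_mult ennreal_plus)
    also have "\<dots> = ennreal c * fock_nn p f + ennreal d * fock_nn p g"
      by (simp add: nn_integral_add nn_integral_cmult fock_nn_def)
    also have "\<dots> = ennreal (c * (2 * pi / p * fock_norm p f powr p) + d * (2 * pi / p * fock_norm p g powr p))"
      using cd p by (simp add: fock_nn_eq_norm[OF f] fock_nn_eq_norm[OF g] flip: ennreal_mult ennreal_plus)
    also have "\<dots> \<le> ennreal (c * (2 * pi / p * A powr p) + d * (2 * pi / p * B powr p))"
      using A B cd p by (intro ennreal_leI add_mono mult_left_mono powr_mono2) auto
    also have "c * (2 * pi / p * A powr p) + d * (2 * pi / p * B powr p)
        = 2 * pi / p * (c * A powr p + d * B powr p)"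
      by (simp add: algebra_simps)
    also have "c * A powr p + d * B powr p = (A + B) powr p * ((A + B) / (A + B))"
      unfolding c_def d_def using pos by (simp only: add_divide_distrib distrib_left) simp
    also have "\<dots> = (A + B) powr p" using pos by simp
    finally show ?thesis .
  qed
  have p0: "p > 0" using p by simp
  have nn: "0 \<le> fock_norm p f" "0 \<le> fock_norm p g" by simp_all
  show "h \<in> fock_space p"
    by (rule fock_space_normI(1)[OF h p0 _ key[of "fock_norm p f + 1" "fock_norm p g + 1"]]) (use nn in auto)
  show "fock_norm p h \<le> fock_norm p f + fock_norm p g"
  proof (rule field_le_epsilon)
    fix e :: real assume "e > 0"
    then have "fock_norm p h \<le> (fock_norm p f + e / 2) + (fock_norm p g + e / 2)"
      by (intro fock_space_normI(2)[OF h p0 _ key]) (use nn in auto)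
    then show "fock_norm p h \<le> fock_norm p f + fock_norm p g + e" by simp
  qed
qed

text \<open>The Poisson kernel of the unit disc at the real point \<open>r\<close>. The angle is 2
  pi t, so that its mass over [0,1] is one.\<close>

definition poisson :: "real \<Rightarrow> real \<Rightarrow> real" where
  "poisson r t = (1 - r\<^sup>2) / (norm (1 - of_real r * cis (2 * pi * t)))\<^sup>2"

lemma poisson_denominator_nonzero:
  assumes "0 \<le> r" "r < 1"
  shows "1 - of_real r * cis x \<noteq> 0"
proof
  assume "1 - of_real r * cis x = 0"
  then have "norm (of_real r * cis x) = norm (1::complex)" by simp
  then show False using assms by (simp add: norm_mult)
qed

lemma poisson_nonneg: "0 \<le> r \<Longrightarrow> r < 1 \<Longrightarrow> 0 \<le> poisson r t"
  by (simp add: poisson_def power_le_one)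

lemma continuous_on_poisson [continuous_intros]:
  assumes "0 \<le> r" "r < 1"
  shows "continuous_on S (poisson r)"
  unfolding poisson_def using poisson_denominator_nonzero[OF assms]
  by (auto intro!: continuous_intros)

text \<open>Cauchy's formula at \<open>r\<close> for \<open>H\<close>, not for \<open>h\<close>: the
  extra factor (1 - r^2)/(1 - r w) has its pole outside the closed disc and equals 1 at w = r. On
  the circle w - r = w (1 - r cnj w), so the two denominators multiply to |1 - r w|^2, and
  \<open>w\<close> cancels against the derivative of the path.\<close>

lemma has_integral_poisson:
  assumes h: "h holomorphic_on UNIV" and r: "0 \<le> r" "r < 1"
  shows "((\<lambda>t. of_real (poisson r t) * h (cis (2 * pi * t))) has_integral h (of_real r)) {0..1}"
proof -
  define H where "H w = h w * (1 - of_real r ^ 2) / (1 - of_real r * w)" for w :: complex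
  have nz: "1 - of_real r * w \<noteq> 0" if "w \<in> cball 0 1" for w :: complex
  proof
    assume "1 - of_real r * w = 0"
    then have "norm (of_real r * w) = norm (1::complex)" by simp
    then have "r * norm w = 1" using r by (simp add: norm_mult)
    moreover have "r * norm w \<le> r * 1" using that r by (intro mult_left_mono) auto
    ultimately show False using r by simp
  qed
  have "H holomorphic_on cball 0 1"
    unfolding H_def using nz by (intro holomorphic_intros holomorphic_on_subset[OF h]) auto
  then have "((\<lambda>u. H u / (u - of_real r)) has_contour_integral (2 * of_real pi * \<i> * H (of_real r))) (circlepath 0 1)"
    by (rule Cauchy_integral_circlepath_simple) (use r in auto)
  moreover have "H (of_real r) = h (of_real r)"
    using nz[of "of_real r"] r by (simp add: H_def power2_eq_square)
  ultimately have "((\<lambda>x. H (circlepath 0 1 x) / (circlepath 0 1 x - of_real r) * vector_derivative (circlepath 0 1) (at x within {0..1}))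
      has_integral (2 * of_real pi * \<i> * h (of_real r))) {0..1}"
    by (simp add: has_contour_integral_def)
  from has_integral_mult_right[OF this, of "1 / (2 * of_real pi * \<i>)"]
  have "((\<lambda>x. 1 / (2 * of_real pi * \<i>) * (H (circlepath 0 1 x) / (circlepath 0 1 x - of_real r) * vector_derivative (circlepath 0 1) (at x within {0..1})))
      has_integral h (of_real r)) {0..1}" by simp
  then show ?thesis
  proof (rule has_integral_eq[rotated])
    fix x :: real assume x: "x \<in> {0..1}"
    define w where "w = cis (2 * pi * x)"
    have ww: "w * cnj w = 1" by (simp add: w_def cis_cnj cis_mult)
    have e: "exp (2 * complex_of_real pi * \<i> * complex_of_real x) = w"
      by (simp add: w_def cis_conv_exp algebra_simps)
    have n1: "1 - of_real r * w \<noteq> 0" using nz[of w] by (simp add: w_def)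
    have n2: "1 - of_real r * cnj w \<noteq> 0" using nz[of "cnj w"] by (simp add: w_def)
    have n3: "w \<noteq> 0" by (simp add: w_def)
    have wr: "w - of_real r = w * (1 - of_real r * cnj w)"
      using ww by (simp add: algebra_simps)
    have "of_real ((norm (1 - of_real r * w))\<^sup>2) = (1 - of_real r * w) * (1 - of_real r * cnj w)"
      by (simp only: complex_norm_square complex_cnj_diff complex_cnj_mult complex_cnj_one complex_cnj_complex_of_real)
    then have "of_real (poisson r x) = (1 - of_real r ^ 2) / ((1 - of_real r * w) * (1 - of_real r * cnj w))"
      unfolding poisson_def of_real_divide w_def[symmetric] by simp
    moreover have vd: "vector_derivative (circlepath 0 1) (at x within {0..1}) = 2 * of_real pi * \<i> * w"
      using x by (simp add: vector_derivative_circlepath01 e)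
    moreover have cancel: "1 / k * (X / (u * y) * (k * u)) = X / y" if "k \<noteq> 0" "u \<noteq> 0" for k u X y :: complex
      using that by simp
    moreover have cp: "circlepath 0 1 x = w" by (simp add: circlepath e)
    ultimately show "1 / (2 * of_real pi * \<i>) * (H (circlepath 0 1 x) / (circlepath 0 1 x - of_real r) * vector_derivative (circlepath 0 1) (at x within {0..1}))
       = of_real (poisson r x) * h (cis (2 * pi * x))"
      using cancel[of "2 * of_real pi * \<i>" w "H w"] n3 unfolding vd cp wr w_def[symmetric]
      by (simp add: H_def mult.commute)
  qed
qed

lemma has_integral_poisson_1:
  assumes "0 \<le> r" "r < 1"
  shows "(poisson r has_integral 1) {0..1}"
proof -
  have "((\<lambda>t. of_real (poisson r t) * 1) has_integral (1::complex)) {0..1}"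
    using has_integral_poisson[of "\<lambda>_. 1", OF _ assms] by simp
  from has_integral_Re[OF this] show ?thesis by simp
qed

text \<open>Jensen's inequality for the probability density \<open>poisson r\<close>: the tangent of
  x^p at x = |h(r)| is integrated. Its linear term contributes a nonnegative amount, because |h(r)|
  is at most the Poisson average of |h| and the slope \<open>c\<close> is nonnegative.\<close>

lemma powr_norm_le_poisson:
  assumes h: "h holomorphic_on UNIV" and r: "0 \<le> r" "r < 1" and p: "p \<ge> 1"
  shows "norm (h (of_real r)) powr p \<le> integral {0..1} (\<lambda>t. poisson r t * norm (h (cis (2 * pi * t))) powr p)"
proof -
  define u where "u t = norm (h (cis (2 * pi * t)))" for t
  define x where "x = norm (h (of_real r))"
  have ch: "continuous_on UNIV h" using h by (rule holomorphic_on_imp_continuous_on)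
  have cu: "continuous_on {0..1} u"
    unfolding u_def by (intro continuous_intros continuous_on_compose2[OF ch]) auto
  note cP = continuous_on_poisson[OF r]
  have iu: "(\<lambda>t. poisson r t * u t) integrable_on {0..1}"
    by (intro integrable_continuous_real continuous_intros cu cP)
  have iup: "(\<lambda>t. poisson r t * u t powr p) integrable_on {0..1}"
    using p by (intro integrable_continuous_real continuous_on_mult cP continuous_on_powr' cu continuous_on_const)
      (auto simp: u_def)
  have "x = norm (integral {0..1} (\<lambda>t. of_real (poisson r t) * h (cis (2 * pi * t))))"
    using has_integral_poisson[OF h r] by (simp add: x_def integral_unique)
  also have "\<dots> \<le> integral {0..1} (\<lambda>t. poisson r t * u t)"
    using has_integral_poisson[OF h r] iu poisson_nonneg[OF r]
    by (intro integral_norm_bound_integral) (auto simp: u_def norm_mult)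
  finally have le: "x \<le> integral {0..1} (\<lambda>t. poisson r t * u t)" .
  define c where "c = p * x powr (p - 1)"
  have c: "c \<ge> 0" using p by (simp add: c_def)
  have i1: "((\<lambda>t. (x powr p - c * x) * poisson r t + c * (poisson r t * u t)) has_integral
      (x powr p - c * x) * 1 + c * integral {0..1} (\<lambda>t. poisson r t * u t)) {0..1}"
    by (intro has_integral_add has_integral_mult_right has_integral_poisson_1 r integrable_integral iu)
  have "x powr p \<le> (x powr p - c * x) * 1 + c * integral {0..1} (\<lambda>t. poisson r t * u t)"
    using mult_left_mono[OF le c] by simp
  also have "\<dots> \<le> integral {0..1} (\<lambda>t. poisson r t * u t powr p)"
  proof (rule has_integral_le[OF i1 integrable_integral[OF iup]])
    fix t :: real
    have "x powr p + c * (u t - x) \<le> u t powr p"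
      unfolding c_def by (rule powr_above_tangent) (use p in \<open>auto simp: x_def u_def\<close>)
    from mult_left_mono[OF this poisson_nonneg[OF r, of t]]
    show "(x powr p - c * x) * poisson r t + c * (poisson r t * u t) \<le> poisson r t * u t powr p"
      by (simp add: algebra_simps)
  qed
  finally show ?thesis by (simp add: x_def u_def)
qed

section \<open>Dilations and kernels\<close>

lemma continuous_on_powr_norm:
  assumes "continuous_on S f" "p > 0"
  shows "continuous_on S (\<lambda>x. norm (f x) powr p)"
  using assms by (intro continuous_on_powr' continuous_on_norm continuous_on_const) auto

text \<open>The Poisson formula writes \<open>f (r z)\<close> as an average of the rotations of \<open>f\<close>, each of which
  has the same norm.\<close>

lemma fock_nn_dilation_le:
  assumes f: "f holomorphic_on UNIV" and r: "0 \<le> r" "r < 1" and p: "p \<ge> 1"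
  shows "fock_nn p (\<lambda>z. f (of_real r * z)) \<le> fock_nn p f"
proof -
  note [measurable] = borel_measurable_fock_density[OF f, of p]
  have "continuous_on UNIV f" using f by (rule holomorphic_on_imp_continuous_on)
  then have cf: "continuous_on UNIV (\<lambda>z. norm (f z) powr p)"
    using p by (intro continuous_on_powr_norm) auto
  have [measurable]: "poisson r \<in> borel_measurable borel"
    by (intro borel_measurable_continuous_onI continuous_on_poisson r)
  have [measurable]: "(\<lambda>t. cis (2 * pi * t)) \<in> borel_measurable borel"
    by (intro borel_measurable_continuous_onI continuous_intros)
  define P where "P t = ennreal (poisson r t) * indicator {0..1} t" for t
  have [measurable]: "P \<in> borel_measurable borel" unfolding P_def by measurable
  have pt: "ennreal (fock_density p (\<lambda>z. f (of_real r * z)) z)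
      \<le> (\<integral>\<^sup>+t. P t * ennreal (fock_density p f (cis (2 * pi * t) * z)) \<partial>lborel)" for z
  proof -
    define e where "e = exp (- (p * (norm z)\<^sup>2 / 2))"
    define g where "g t = poisson r t * norm (f (cis (2 * pi * t) * z)) powr p" for t
    have g: "continuous_on {0..1} g" unfolding g_def
      by (intro continuous_intros r continuous_on_compose2[OF cf]) auto
    then have gi: "(g has_integral integral {0..1} g) {0..1}"
      by (intro integrable_integral integrable_continuous_real)
    have g0: "g t \<ge> 0" for t using poisson_nonneg[OF r] by (simp add: g_def)
    have "norm ((\<lambda>w. f (w * z)) (of_real r)) powr p \<le> integral {0..1} (\<lambda>t. poisson r t * norm ((\<lambda>w. f (w * z)) (cis (2 * pi * t))) powr p)"
      by (intro powr_norm_le_poisson r p holomorphic_on_compose_gen[OF _ f, unfolded o_def] holomorphic_intros) auto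
    then have "norm (f (of_real r * z)) powr p \<le> integral {0..1} g"
      by (simp add: g_def[abs_def])
    then have "ennreal (fock_density p (\<lambda>z. f (of_real r * z)) z) \<le> ennreal (integral {0..1} g * e)"
      by (intro ennreal_leI) (simp add: fock_density_def e_def mult_right_mono)
    also have "\<dots> = (\<integral>\<^sup>+t. ennreal (g t * e) * indicator {0..1} t \<partial>lborel)"
      by (rule nn_integral_has_integral_lebesgue'[symmetric])
         (use g0 has_integral_mult_left[OF gi, of e] in \<open>auto simp: e_def\<close>)
    also have "\<dots> = (\<integral>\<^sup>+t. P t * ennreal (fock_density p f (cis (2 * pi * t) * z)) \<partial>lborel)"
      using poisson_nonneg[OF r]
      by (intro nn_integral_cong)
         (auto simp: P_def g_def fock_density_def e_def norm_mult mult.assoc ennreal_mult split: split_indicator)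
    finally show ?thesis .
  qed
  have "fock_nn p (\<lambda>z. f (of_real r * z))
      \<le> (\<integral>\<^sup>+z. \<integral>\<^sup>+t. P t * ennreal (fock_density p f (cis (2 * pi * t) * z)) \<partial>lborel \<partial>lborel)"
    unfolding fock_nn_def by (intro nn_integral_mono pt)
  also have "\<dots> = (\<integral>\<^sup>+t. \<integral>\<^sup>+z. P t * ennreal (fock_density p f (cis (2 * pi * t) * z)) \<partial>lborel \<partial>lborel)"
    by (rule lborel_pair.Fubini') measurable
  also have "\<dots> = (\<integral>\<^sup>+t. P t * fock_nn p f \<partial>lborel)"
  proof (rule nn_integral_cong)
    fix t :: real
    have "(\<integral>\<^sup>+z. ennreal (fock_density p f (cis (2 * pi * t) * z)) \<partial>lborel) = fock_nn p f"
      using nn_integral_complex_affine[of "\<lambda>z. ennreal (fock_density p f z)" "cis (2 * pi * t)" 0]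
      by (simp add: fock_nn_def)
    then show "(\<integral>\<^sup>+z. P t * ennreal (fock_density p f (cis (2 * pi * t) * z)) \<partial>lborel) = P t * fock_nn p f"
      by (subst nn_integral_cmult) auto
  qed
  also have "\<dots> = (\<integral>\<^sup>+t. P t \<partial>lborel) * fock_nn p f"
    by (rule nn_integral_multc) simp
  also have "(\<integral>\<^sup>+t. P t \<partial>lborel) = ennreal 1"
    unfolding P_def by (rule nn_integral_has_integral_lebesgue'[OF _ has_integral_poisson_1[OF r]])
      (use poisson_nonneg[OF r] in auto)
  finally show ?thesis by simp
qed

lemma holomorphic_compose_affine:
  assumes "f holomorphic_on UNIV"
  shows "(\<lambda>z. f (a * z + b)) holomorphic_on UNIV"
  by (rule holomorphic_on_compose_gen[OF _ assms, unfolded o_def]) (auto intro!: holomorphic_intros)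

lemma fock_dilation:
  assumes f: "f \<in> fock_space p" and r: "0 \<le> r" "r < 1" and p: "p \<ge> 1"
  shows "(\<lambda>z. f (of_real r * z)) \<in> fock_space p" "fock_norm p (\<lambda>z. f (of_real r * z)) \<le> fock_norm p f"
proof -
  have h: "(\<lambda>z. f (of_real r * z)) holomorphic_on UNIV"
    using holomorphic_compose_affine[OF fock_spaceD[OF f], of "of_real r" 0] by simp
  have le: "fock_nn p (\<lambda>z. f (of_real r * z)) \<le> ennreal (2 * pi / p * fock_norm p f powr p)"
    using fock_nn_dilation_le[OF fock_spaceD[OF f] r p] fock_nn_eq_norm[OF f] p by simp
  show "(\<lambda>z. f (of_real r * z)) \<in> fock_space p" "fock_norm p (\<lambda>z. f (of_real r * z)) \<le> fock_norm p f"
    by (rule fock_space_normI[OF h _ _ le]; use p in simp)+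
qed

section \<open>Point evaluations, normalised kernels and the embedding between Fock spaces\<close>

lemma nn_integral_gaussian_fock:
  assumes "p > 0"
  shows "(\<integral>\<^sup>+z. ennreal (exp (- (p * (norm (z - w))\<^sup>2 / 2))) \<partial>(lborel :: complex measure)) = ennreal (2 * pi / p)"
proof -
  have "(\<integral>\<^sup>+z. ennreal (exp (- (p * (norm (z + (- w)))\<^sup>2 / 2))) \<partial>(lborel :: complex measure))
     = (\<integral>\<^sup>+z. ennreal (exp (- (p / 2 * (norm (z :: complex))\<^sup>2))) \<partial>lborel)"
    by (subst nn_integral_lborel_plus[of "\<lambda>z. ennreal (exp (- (p * (norm z)\<^sup>2 / 2)))"]) auto
  also have "\<dots> = ennreal (2 * pi / p)"
    using assms by (subst nn_integral_gaussian_complex) (auto simp: field_simps)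
  finally show ?thesis by simp
qed

text \<open>The dilation with r = 0 turns \<open>f\<close> into the constant \<open>f 0\<close>,
  whose norm is |f(0)| by the normalisation of the integral; dilations do not increase the
  norm.\<close>

lemma norm_at_0_le_fock_norm:
  assumes f: "f \<in> fock_space p" and p: "p \<ge> 1"
  shows "norm (f 0) \<le> fock_norm p f"
proof -
  have "ennreal (2 * pi / p * norm (f 0) powr p) = ennreal (norm (f 0) powr p) * ennreal (2 * pi / p)"
    using p by (simp add: mult.commute flip: ennreal_mult)
  also have "\<dots> = ennreal (norm (f 0) powr p) * (\<integral>\<^sup>+z. ennreal (exp (- (p * (norm (z - 0))\<^sup>2 / 2))) \<partial>(lborel :: complex measure))"
    using p by (subst nn_integral_gaussian_fock) auto
  also have "\<dots> = fock_nn p (\<lambda>z. f (of_real 0 * z))"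
    unfolding fock_nn_def fock_density_def by (subst nn_integral_cmult[symmetric]) (auto simp: ennreal_mult)
  also have "\<dots> \<le> fock_nn p f"
    by (rule fock_nn_dilation_le) (use f p fock_spaceD in auto)
  also have "\<dots> = ennreal (2 * pi / p * fock_norm p f powr p)"
    using f p by (intro fock_nn_eq_norm) auto
  finally have le: "norm (f 0) powr p \<le> fock_norm p f powr p"
    using p by (simp add: divide_simps)
  show ?thesis
  proof (rule ccontr)
    assume "\<not> ?thesis"
    then have "fock_norm p f powr p < norm (f 0) powr p" using p by (intro powr_less_mono2) auto
    with le show False by simp
  qed
qed

definition fock_kernel :: "complex \<Rightarrow> complex \<Rightarrow> complex" where
  "fock_kernel w z = exp (cnj w * z - of_real ((norm w)\<^sup>2 / 2))"

lemma holomorphic_fock_kernel [holomorphic_intros]: "fock_kernel w holomorphic_on S"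
  unfolding fock_kernel_def by (intro holomorphic_intros)

lemma norm_fock_kernel:
  "norm (fock_kernel w z) * exp (- ((norm z)\<^sup>2 / 2)) = exp (- ((norm (z - w))\<^sup>2 / 2))"
proof -
  have "(norm (z - w))\<^sup>2 = (norm z)\<^sup>2 + (norm w)\<^sup>2 - 2 * Re (cnj w * z)"
    unfolding cmod_power2 by (simp add: power2_eq_square algebra_simps)
  then show ?thesis
    by (simp add: fock_kernel_def diff_divide_distrib add_divide_distrib flip: exp_add)
qed

lemma fock_kernel_space:
  assumes "p > 0"
  shows "fock_kernel w \<in> fock_space p" "fock_norm p (fock_kernel w) \<le> 1"
proof -
  have nn: "fock_nn p (fock_kernel w) = ennreal (2 * pi / p)"
    using nn_integral_gaussian_fock[OF assms, of w]
    by (simp add: fock_nn_def fock_density_eq norm_fock_kernel exp_powr_real mult.commute)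
  show "fock_kernel w \<in> fock_space p" "fock_norm p (fock_kernel w) \<le> 1"
    by (rule fock_space_normI[of _ p 1]; use assms nn in \<open>auto intro: holomorphic_intros\<close>)+
qed

text \<open>The weighted translation \<open>g\<close> is an isometry that moves the point
  \<open>w\<close> to the origin: completing the square absorbs the shift of the Gaussian weight
  into the exponential factor. The multiplier \<open>1\<close> in its definition only matches
  \<open>holomorphic_compose_affine\<close>.\<close>

lemma norm_le_fock_norm:
  assumes f: "f \<in> fock_space p" and p: "p \<ge> 1"
  shows "norm (f w) * exp (- ((norm w)\<^sup>2 / 2)) \<le> fock_norm p f"
proof -
  define g where "g z = f (1 * z + w) * exp (- (cnj w * z) - of_real ((norm w)\<^sup>2 / 2))" for z
  have g: "g holomorphic_on UNIV"
    unfolding g_def by (intro holomorphic_intros holomorphic_compose_affine fock_spaceD[OF f])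
  note [measurable] = borel_measurable_fock_density[OF fock_spaceD[OF f], of p]
  have d: "fock_density p g z = fock_density p f (z + w)" for z
  proof -
    have "(norm (z + w))\<^sup>2 = (norm z)\<^sup>2 + (norm w)\<^sup>2 + 2 * Re (cnj w * z)"
      unfolding cmod_power2 by (simp add: power2_eq_square algebra_simps)
    then have "norm (exp (- (cnj w * z) - of_real ((norm w)\<^sup>2 / 2))) * exp (- ((norm z)\<^sup>2 / 2))
        = exp (- ((norm (z + w))\<^sup>2 / 2))"
      by (simp add: diff_divide_distrib add_divide_distrib flip: exp_add)
    then show ?thesis
      by (simp add: fock_density_eq g_def norm_mult mult.assoc)
  qed
  have nn: "fock_nn p g = fock_nn p f"
    unfolding fock_nn_def d by (rule nn_integral_lborel_plus[of "\<lambda>z. ennreal (fock_density p f z)"]) simp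
  have "norm (g 0) \<le> fock_norm p g"
    by (intro norm_at_0_le_fock_norm fock_norm_cong_nn(1)[OF f g _ nn] p) (use p in simp)
  also have "\<dots> = fock_norm p f"
    by (rule fock_norm_cong_nn(2)[OF f g _ nn]) (use p in simp)
  finally show ?thesis by (simp add: g_def norm_mult)
qed

lemma norm_le_fock_norm':
  assumes f: "f \<in> fock_space p" and p: "p \<ge> 1"
  shows "norm (f w) \<le> fock_norm p f * exp ((norm w)\<^sup>2 / 2)"
  using norm_le_fock_norm[OF assms, of w] by (simp add: exp_minus field_simps)

text \<open>Of the q-th power of the weighted modulus, q - p factors are bounded by the norm and the
  other p are integrated. The factor 2 pi/p, instead of 2 pi/q, is the origin of q/p in the final
  estimate.\<close>

lemma fock_embedding:
  assumes f: "f \<in> fock_space p" and p: "1 \<le> p" "p \<le> q"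
  shows "fock_nn q f \<le> ennreal (2 * pi / p * fock_norm p f powr q)"
proof -
  note [measurable] = borel_measurable_fock_density[OF fock_spaceD[OF f], of p]
  define N where "N = fock_norm p f powr (q - p)"
  have pt: "fock_density q f z \<le> N * fock_density p f z" for z
  proof -
    define x where "x = norm (f z) * exp (- ((norm z)\<^sup>2 / 2))"
    have x: "x \<ge> 0" "x \<le> fock_norm p f" using norm_le_fock_norm[OF f p(1)] by (auto simp: x_def)
    have "x powr q = x powr (q - p) * x powr p" by (simp flip: powr_add)
    also have "\<dots> \<le> N * x powr p"
      unfolding N_def using x p by (intro mult_right_mono powr_mono2) auto
    finally show ?thesis by (simp add: fock_density_eq x_def)
  qed
  have "fock_nn q f \<le> (\<integral>\<^sup>+z. ennreal N * ennreal (fock_density p f z) \<partial>lborel)"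
    unfolding fock_nn_def by (intro nn_integral_mono) (use pt in \<open>simp add: N_def flip: ennreal_mult\<close>)
  also have "\<dots> = ennreal N * ennreal (2 * pi / p * fock_norm p f powr p)"
    using fock_nn_eq_norm[OF f] p by (subst nn_integral_cmult) (auto simp: fock_nn_def)
  also have "\<dots> = ennreal (2 * pi / p * (N * fock_norm p f powr p))"
    using p by (simp add: N_def mult_ac flip: ennreal_mult)
  also have "N * fock_norm p f powr p = fock_norm p f powr q"
    by (simp add: N_def flip: powr_add)
  finally show ?thesis .
qed

section \<open>The lower bound\<close>

lemma separated_ge:
  fixes s :: "nat \<Rightarrow> real"
  assumes "\<And>n. s n + 1 \<le> s (Suc n)" "i \<le> j"
  shows "s i + (real j - real i) \<le> s j"
proof -
  have "s i + real k \<le> s (i + k)" for k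
  proof (induction k)
    case (Suc k)
    then show ?case using assms(1)[of "i + k"] by simp
  qed simp
  from this[of "j - i"] show ?thesis using assms(2) by (simp add: of_nat_diff)
qed

lemma exp_minus_le_half_power:
  assumes "real i \<le> x"
  shows "exp (- x) \<le> (1 / 2) ^ i"
proof -
  have "exp (- x) \<le> exp (- real i)" using assms by simp
  also have "\<dots> = exp (- 1) ^ i" by (simp flip: exp_of_nat_mult)
  also have "\<dots> \<le> (1 / 2) ^ i"
    using exp_ge_add_one_self[of 1] by (intro power_mono) (auto simp: exp_minus field_simps)
  finally show ?thesis .
qed

text \<open>On either side of \<open>t\<close> the distances grow by at least one per index, so the
  sum is dominated by two geometric series with ratio 1/2, each at most 2.\<close>

lemma sum_exp_separated_le:
  fixes s :: "nat \<Rightarrow> real"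
  assumes sep: "\<And>n. s n + 1 \<le> s (Suc n)"
  shows "(\<Sum>j<N. exp (- \<bar>t - s j\<bar>)) \<le> 4"
proof -
  have geo: "(\<Sum>i<k. (1 / 2) ^ i) \<le> (2::real)" for k :: nat
    by (simp add: geometric_sum)
  \<comment> \<open>\<open>m\<close> is the first index with s m > t; the alternative m = N is a
    sentinel for the case that no point up to \<open>N\<close> exceeds \<open>t\<close>. Below
    \<open>m\<close> the comparison point is s (m - 1), hence the exponent
    \<open>m - Suc j\<close>.\<close>
  define m where "m = (LEAST m. m = N \<or> t < s m)"
  have m: "m = N \<or> t < s m" unfolding m_def by (rule LeastI[of _ N]) simp
  have mN: "m \<le> N" unfolding m_def by (rule Least_le) simp
  have below: "s j \<le> t" if "j < m" for j
    using not_less_Least[of j "\<lambda>m. m = N \<or> t < s m"] that by (auto simp: m_def)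
  have split: "{..<N} = {..<m} \<union> {m..<N}" using mN by auto
  have "(\<Sum>j<N. exp (- \<bar>t - s j\<bar>)) = (\<Sum>j<m. exp (- \<bar>t - s j\<bar>)) + (\<Sum>j=m..<N. exp (- \<bar>t - s j\<bar>))"
    unfolding split by (rule sum.union_disjoint) auto
  also have "(\<Sum>j<m. exp (- \<bar>t - s j\<bar>)) \<le> (\<Sum>j<m. (1 / 2) ^ (m - Suc j))"
  proof (intro sum_mono exp_minus_le_half_power)
    fix j assume "j \<in> {..<m}"
    then have "j \<le> m - 1" "m - 1 < m" by auto
    then show "real (m - Suc j) \<le> \<bar>t - s j\<bar>"
      using separated_ge[of s j "m - 1", OF sep] below[of "m - 1"] by (simp add: of_nat_diff)
  qed
  also have "\<dots> = (\<Sum>i<m. (1 / 2) ^ i)" by (rule sum.nat_diff_reindex)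
  also have "\<dots> \<le> 2" by (rule geo)
  also have "(\<Sum>j=m..<N. exp (- \<bar>t - s j\<bar>)) \<le> (\<Sum>j=m..<N. (1 / 2) ^ (j - m))"
  proof (intro sum_mono exp_minus_le_half_power)
    fix j assume "j \<in> {m..<N}"
    then show "real (j - m) \<le> \<bar>t - s j\<bar>"
      using separated_ge[of s m j, OF sep] m by (auto simp: of_nat_diff)
  qed
  also have "\<dots> = (\<Sum>i<N - m. (1 / 2) ^ i)"
    using mN by (intro sum.reindex_bij_witness[of _ "\<lambda>i. i + m" "\<lambda>j. j - m"]) auto
  also have "\<dots> \<le> 2" by (rule geo)
  finally show ?thesis by simp
qed

text \<open>The distance is at least the difference of the moduli, and x^2/2 >= x - 1/2 turns
  Gaussians into exponentials at the cost of exp(1/2) <= 2; thus 8 = 2 * 4.\<close>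

lemma sum_gaussian_separated_le:
  fixes w :: "nat \<Rightarrow> complex"
  assumes sep: "\<And>n. norm (w n) + 1 \<le> norm (w (Suc n))"
  shows "(\<Sum>j<N. exp (- ((norm (z - w j))\<^sup>2 / 2))) \<le> 8"
proof -
  have "exp (- ((norm (z - w j))\<^sup>2 / 2)) \<le> 2 * exp (- \<bar>norm z - norm (w j)\<bar>)" for j
  proof -
    have "\<bar>norm z - norm (w j)\<bar> \<le> norm (z - w j)" by (rule norm_triangle_ineq3)
    also have "2 * norm (z - w j) \<le> (norm (z - w j))\<^sup>2 + 1"
      using sum_squares_ge_zero[of "norm (z - w j) - 1" 0] by (simp add: power2_eq_square algebra_simps)
    finally have "- ((norm (z - w j))\<^sup>2 / 2) \<le> 1 / 2 + - \<bar>norm z - norm (w j)\<bar>" by simp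
    then have "exp (- ((norm (z - w j))\<^sup>2 / 2)) \<le> exp (1 / 2) * exp (- \<bar>norm z - norm (w j)\<bar>)"
      by (simp flip: exp_add)
    also have "\<dots> \<le> 2 * exp (- \<bar>norm z - norm (w j)\<bar>)"
      using exp_half_le2 by (intro mult_right_mono) auto
    finally show ?thesis .
  qed
  then have "(\<Sum>j<N. exp (- ((norm (z - w j))\<^sup>2 / 2))) \<le> (\<Sum>j<N. 2 * exp (- \<bar>norm z - norm (w j)\<bar>))"
    by (intro sum_mono)
  also have "\<dots> = 2 * (\<Sum>j<N. exp (- \<bar>norm z - norm (w j)\<bar>))" by (simp add: sum_distrib_left)
  also have "\<dots> \<le> 2 * 4" using sum_exp_separated_le[of "\<lambda>n. norm (w n)", OF sep] by (intro mult_left_mono) auto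
  finally show ?thesis by simp
qed

text \<open>The weighted modulus of the sum is at most some x <= 8, so x^p <= 8^(p-1) x, and the
  integral of x is linear in \<open>N\<close>. The norm thus grows like N^(1/p) rather than
  N.\<close>

lemma fock_kernel_sum:
  fixes w :: "nat \<Rightarrow> complex"
  assumes sep: "\<And>n. norm (w n) + 1 \<le> norm (w (Suc n))" and p: "p \<ge> 1"
  shows "(\<lambda>z. \<Sum>j<N. fock_kernel (w j) z) \<in> fock_space p"
    and "fock_norm p (\<lambda>z. \<Sum>j<N. fock_kernel (w j) z) \<le> (p * 8 powr (p - 1)) powr (1 / p) * real N powr (1 / p)"
proof -
  define F where "F z = (\<Sum>j<N. fock_kernel (w j) z)" for z
  define c where "c = (8::real) powr (p - 1)"
  have c: "c \<ge> 0" by (simp add: c_def)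
  have F: "F holomorphic_on UNIV" unfolding F_def by (intro holomorphic_intros)
  have pt: "fock_density p F z \<le> c * (\<Sum>j<N. exp (- ((norm (z - w j))\<^sup>2 / 2)))" for z
  proof -
    define x where "x = (\<Sum>j<N. exp (- ((norm (z - w j))\<^sup>2 / 2)))"
    have x: "0 \<le> x" "x \<le> 8" using sum_gaussian_separated_le[of w, OF sep] by (auto simp: x_def intro: sum_nonneg)
    have "norm (F z) * exp (- ((norm z)\<^sup>2 / 2)) \<le> (\<Sum>j<N. norm (fock_kernel (w j) z)) * exp (- ((norm z)\<^sup>2 / 2))"
      unfolding F_def by (intro mult_right_mono norm_sum) simp
    also have "\<dots> = x" by (simp add: x_def sum_distrib_right norm_fock_kernel)
    finally have "fock_density p F z \<le> x powr p"
      unfolding fock_density_eq using p by (intro powr_mono2) auto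
    also have "\<dots> = x powr (p - 1) * x"
      using x by (cases "x = 0") (use powr_add[of x "p - 1" 1] in auto)
    also have "\<dots> \<le> c * x" unfolding c_def using x p by (intro mult_right_mono powr_mono2) auto
    finally show ?thesis by (simp add: x_def)
  qed
  \<comment> \<open>The factor \<open>1\<close> makes each summand an instance of
    \<open>nn_integral_gaussian_fock\<close> with exponent 1, whose value is 2 pi.\<close>
  have "fock_nn p F \<le> (\<integral>\<^sup>+z. (\<Sum>j<N. ennreal c * ennreal (exp (- (1 * (norm (z - w j))\<^sup>2 / 2)))) \<partial>lborel)"
    unfolding fock_nn_def using pt c
    by (intro nn_integral_mono) (auto simp: sum_distrib_left intro!: ennreal_leI simp flip: ennreal_mult)
  also have "\<dots> = (\<Sum>j<N. ennreal c * (\<integral>\<^sup>+z. ennreal (exp (- (1 * (norm (z - w j))\<^sup>2 / 2))) \<partial>lborel))"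
    by (subst nn_integral_sum) (auto simp: nn_integral_cmult)
  also have "\<dots> = ennreal (c * (2 * pi) * real N)"
    using c by (subst nn_integral_gaussian_fock) (auto simp: ennreal_mult' ennreal_of_nat_eq_real_of_nat mult_ac)
  also have "c * (2 * pi) * real N = 2 * pi / p * ((p * c) powr (1 / p) * real N powr (1 / p)) powr p"
    using p c by (simp add: powr_mult powr_powr)
  finally have le: "fock_nn p F \<le> ennreal (2 * pi / p * ((p * c) powr (1 / p) * real N powr (1 / p)) powr p)" .
  show "F \<in> fock_space p" "fock_norm p F \<le> (p * c) powr (1 / p) * real N powr (1 / p)"
    by (rule fock_space_normI[OF F _ _ le]; use p in simp)+
qed

lemma fock_linear_sum:
  fixes f :: "nat \<Rightarrow> complex \<Rightarrow> complex"
  assumes K: "fock_linear p q K" and N: "\<And>N. (\<lambda>z. \<Sum>j<N. f j z) \<in> fock_space p"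
    and f: "\<And>j. f j \<in> fock_space p"
  shows "K (\<lambda>z. \<Sum>j<N. f j z) = (\<lambda>z. \<Sum>j<N. K (f j) z)"
proof (induction N)
  case 0
  have "K (\<lambda>z. 0 * f 0 z) = (\<lambda>z. 0 * K (f 0) z)"
    using K f[of 0] unfolding fock_linear_def by blast
  then show ?case by simp
next
  case (Suc N)
  have "K (\<lambda>z. (\<Sum>j<N. f j z) + f N z) = (\<lambda>z. K (\<lambda>z. \<Sum>j<N. f j z) z + K (f N) z)"
    using K N f by (simp add: fock_linear_def)
  then show ?case by (simp add: Suc)
qed

text \<open>A limit \<open>g\<close> of \<open>K (fock_kernel (w n))\<close> must vanish: sums of \<open>N\<close> separated kernels have norm
  \<open>O(N powr (1 / p))\<close>, whereas their images grow like \<open>N * g\<close>. This replaces the weak convergence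
  of the kernels to zero.\<close>

lemma compact_limit_zero:
  assumes K: "fock_bounded_linear p q K" and p: "p > 1" and q: "q \<ge> 1"
    and sep: "\<And>n. norm (w n) + 1 \<le> norm (w (Suc n))"
    and g: "g \<in> fock_space q"
    and lim: "(\<lambda>n. fock_norm q (\<lambda>z. K (fock_kernel (w n)) z - g z)) \<longlonglongrightarrow> 0"
  shows "g z = 0"
proof -
  have lin: "fock_linear p q K" using K by (simp add: fock_bounded_linear_def)
  obtain C where C: "\<And>f. f \<in> fock_space p \<Longrightarrow> fock_norm q (K f) \<le> C * fock_norm p f"
    using K by (auto simp: fock_bounded_linear_def)
  define D where "D = \<bar>C\<bar> * (p * 8 powr (p - 1)) powr (1 / p)"
  define E where "E = exp (- ((norm z)\<^sup>2 / 2))"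
  have kp: "fock_kernel v \<in> fock_space p" for v using p by (intro fock_kernel_space) auto
  have Kq: "K f \<in> fock_space q" if "f \<in> fock_space p" for f
    using lin that by (simp add: fock_linear_def)
  have "norm (g z) * E \<le> 0 + d" if d: "d > 0" for d
  proof -
    \<comment> \<open>Dropping the first \<open>n0\<close> kernels makes every image lie within
      \<open>d\<close> of \<open>g\<close> while the separation survives.\<close>
    obtain n0 where n0: "\<And>n. n \<ge> n0 \<Longrightarrow> fock_norm q (\<lambda>z. K (fock_kernel (w n)) z - g z) < d"
      using order_tendstoD(2)[OF lim d] by (auto simp: eventually_sequentially)
    define v where "v n = w (n0 + n)" for n
    have vsep: "norm (v n) + 1 \<le> norm (v (Suc n))" for n using sep by (simp add: v_def)
    have bound: "norm (g z) * E \<le> D * real N powr (1 / p - 1) + d" if N: "N > 0" for N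
    proof -
      have F: "(\<lambda>z. \<Sum>j<N. fock_kernel (v j) z) \<in> fock_space p" for N
        using fock_kernel_sum(1)[of v p, OF vsep] p by auto
      have "norm (\<Sum>j<N. K (fock_kernel (v j)) z) * E \<le> fock_norm q (K (\<lambda>z. \<Sum>j<N. fock_kernel (v j) z))"
        using norm_le_fock_norm[OF Kq[OF F] q, of N z]
        by (simp add: fock_linear_sum[OF lin F kp] E_def)
      also have "\<dots> \<le> C * fock_norm p (\<lambda>z. \<Sum>j<N. fock_kernel (v j) z)" by (rule C[OF F])
      also have "\<dots> \<le> \<bar>C\<bar> * fock_norm p (\<lambda>z. \<Sum>j<N. fock_kernel (v j) z)"
        by (intro mult_right_mono) auto
      also have "\<dots> \<le> \<bar>C\<bar> * ((p * 8 powr (p - 1)) powr (1 / p) * real N powr (1 / p))"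
        using fock_kernel_sum(2)[of v p N, OF vsep] p by (intro mult_left_mono) auto
      also have "\<dots> = D * real N powr (1 / p)" by (simp add: D_def)
      finally have 1: "norm (\<Sum>j<N. K (fock_kernel (v j)) z) * E \<le> D * real N powr (1 / p)" .
      have 2: "norm (K (fock_kernel (v j)) z - g z) * E \<le> d" for j
      proof -
        have h: "(\<lambda>z. K (fock_kernel (v j)) z - g z) \<in> fock_space q"
          by (rule fock_norm_triangle(1)[OF Kq[OF kp] g _ q])
             (auto intro!: holomorphic_intros fock_spaceD[OF Kq[OF kp]] fock_spaceD[OF g] norm_triangle_ineq4)
        have "norm (K (fock_kernel (v j)) z - g z) * E \<le> fock_norm q (\<lambda>z. K (fock_kernel (v j)) z - g z)"
          unfolding E_def by (rule norm_le_fock_norm[OF h q])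
        also have "\<dots> < d" unfolding v_def by (rule n0) simp
        finally show ?thesis by simp
      qed
      \<comment> \<open>N g is the sum of the images minus the sum of the errors. The former is
        O(N^(1/p)), the latter at most N d; division by N leaves N^(1/p - 1), which tends to 0 as p
        > 1.\<close>
      have "real N * (norm (g z) * E) = norm (of_nat N * g z) * E" by (simp add: norm_mult)
      also have "of_nat N * g z = (\<Sum>j<N. K (fock_kernel (v j)) z) - (\<Sum>j<N. K (fock_kernel (v j)) z - g z)"
        by (simp add: sum_subtractf)
      also have "norm \<dots> * E \<le> (norm (\<Sum>j<N. K (fock_kernel (v j)) z) + (\<Sum>j<N. norm (K (fock_kernel (v j)) z - g z))) * E"
        by (intro mult_right_mono order_trans[OF norm_triangle_ineq4] add_left_mono norm_sum) (simp add: E_def)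
      also have "\<dots> = norm (\<Sum>j<N. K (fock_kernel (v j)) z) * E + (\<Sum>j<N. norm (K (fock_kernel (v j)) z - g z) * E)"
        by (simp add: distrib_right sum_distrib_right)
      also have "\<dots> \<le> D * real N powr (1 / p) + (\<Sum>j<N. d)"
        by (intro add_mono 1 sum_mono 2)
      also have "\<dots> = real N * (D * real N powr (1 / p - 1) + d)"
        using N powr_add[of "real N" "1 / p - 1" 1] by (simp add: distrib_left)
      finally show ?thesis using N by simp
    qed
    have "((\<lambda>N. D * real N powr (1 / p - 1) + d) \<longlongrightarrow> D * 0 + d) sequentially"
      using p by (intro tendsto_intros tendsto_neg_powr filterlim_real_sequentially) auto
    then have "norm (g z) * E \<le> D * 0 + d"
      by (rule tendsto_lowerbound) (use bound in \<open>auto intro: eventually_mono[OF eventually_gt_at_top[of 0]]\<close>)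
    then show ?thesis by simp
  qed
  then have "norm (g z) * E \<le> 0" by (rule field_le_epsilon)
  then show ?thesis by (simp add: E_def mult_le_0_iff)
qed

text \<open>A failure occurs at points of arbitrarily large modulus, hence along a separated
  sequence. Compactness gives a norm limit along a subsequence, which is again separated; this limit
  is zero, against the lower bound \<open>e\<close>.\<close>

lemma compact_kernel_tendsto_0:
  assumes K: "fock_compact p q K" and p: "p > 1" and q: "q \<ge> 1" and e: "e > 0"
  shows "eventually (\<lambda>w. fock_norm q (K (fock_kernel w)) < e) at_infinity"
proof (rule ccontr)
  assume "\<not> ?thesis"
  then have ex: "\<exists>w. b \<le> norm w \<and> e \<le> fock_norm q (K (fock_kernel w))" for b
    by (auto simp: eventually_at_infinity not_less)
  have "\<exists>w. \<forall>n. e \<le> fock_norm q (K (fock_kernel (w n))) \<and> norm (w n) + 1 \<le> norm (w (Suc n))"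
    by (rule dependent_nat_choice) (use ex in blast)+
  then obtain w where w: "\<And>n. e \<le> fock_norm q (K (fock_kernel (w n)))"
    and sep: "\<And>n. norm (w n) + 1 \<le> norm (w (Suc n))" by blast
  have "(\<forall>n. fock_kernel (w n) \<in> fock_space p) \<and> (\<exists>C. \<forall>n. fock_norm p (fock_kernel (w n)) \<le> C)"
    using fock_kernel_space[of p] p by (intro conjI exI[of _ 1]) auto
  then obtain r g where r: "strict_mono r" and g: "g \<in> fock_space q"
    and lim: "(\<lambda>n. fock_norm q (\<lambda>z. K (fock_kernel (w (r n))) z - g z)) \<longlonglongrightarrow> 0"
    using K unfolding fock_compact_def by (elim conjE allE[of _ "\<lambda>n. fock_kernel (w n)"]) auto
  have rsep: "norm (w (r n)) + 1 \<le> norm (w (r (Suc n)))" for n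
  proof -
    have "r n < r (Suc n)" using r by (simp add: strict_mono_Suc_iff)
    then have "1 \<le> real (r (Suc n)) - real (r n)" "r n \<le> r (Suc n)" by linarith+
    then show ?thesis using separated_ge[of "\<lambda>n. norm (w n)" "r n" "r (Suc n)", OF sep] by linarith
  qed
  have "g z = 0" for z
    by (rule compact_limit_zero[where w = "\<lambda>n. w (r n)", OF _ p q rsep g lim]) (use K in \<open>simp add: fock_compact_def\<close>)
  then have "(\<lambda>n. fock_norm q (K (fock_kernel (w (r n))))) \<longlonglongrightarrow> 0" using lim by simp
  then have "e \<le> 0" by (rule tendsto_lowerbound) (use w in auto)
  with e show False by simp
qed

section \<open>Testing the difference on kernels\<close>

lemma norm_weighted_comp:
  "norm (weighted_comp \<psi> \<phi> f z) * exp (- ((norm z)\<^sup>2 / 2))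
     = m_fun \<psi> \<phi> z * (norm (f (\<phi> z)) * exp (- ((norm (\<phi> z))\<^sup>2 / 2)))"
proof -
  have "exp (- ((norm z)\<^sup>2 / 2)) = exp (((norm (\<phi> z))\<^sup>2 - (norm z)\<^sup>2) / 2) * exp (- ((norm (\<phi> z))\<^sup>2 / 2))"
    by (simp add: diff_divide_distrib flip: exp_add)
  then show ?thesis by (simp add: weighted_comp_def m_fun_def norm_mult)
qed

lemma m_fun_nonneg [simp]: "0 \<le> m_fun \<psi> \<phi> z"
  by (simp add: m_fun_def)

lemma fock_op_norm_ge:
  assumes "f \<in> fock_space p" "fock_norm p f \<le> 1"
  shows "ereal (fock_norm q (L f)) \<le> fock_op_norm p q L"
  unfolding fock_op_norm_def using assms by (intro SUP_upper) auto

lemma op_diff_kernel_estimate: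
  fixes \<psi>1 \<psi>2 \<phi>1 \<phi>2 K p q
  defines "L \<equiv> op_diff (weighted_comp \<psi>1 \<phi>1) (weighted_comp \<psi>2 \<phi>2)"
  assumes L: "fock_linear p q L" and K: "fock_linear p q K" and p: "p \<ge> 1" and q: "q \<ge> 1"
    and N: "fock_op_norm p q (op_diff L K) \<le> ereal N"
  shows "(1 - exp (- ((norm (\<phi>1 z - \<phi>2 z))\<^sup>2 / 2))) * (m_fun \<psi>1 \<phi>1 z + m_fun \<psi>2 \<phi>2 z)
    \<le> 2 * N + fock_norm q (K (fock_kernel (\<phi>1 z))) + fock_norm q (K (fock_kernel (\<phi>2 z)))"
proof -
  define E where "E = exp (- ((norm z)\<^sup>2 / 2))"
  define x where "x = exp (- ((norm (\<phi>1 z - \<phi>2 z))\<^sup>2 / 2))"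
  have E: "E > 0" by (simp add: E_def)
  have kp: "fock_kernel w \<in> fock_space p" "fock_norm p (fock_kernel w) \<le> 1" for w
    using p by (auto intro: fock_kernel_space)
  have Lk: "norm (L (fock_kernel w) z) * E \<le> N + fock_norm q (K (fock_kernel w))" for w
  proof -
    have Lq: "L (fock_kernel w) \<in> fock_space q" "K (fock_kernel w) \<in> fock_space q"
      using L K kp by (auto simp: fock_linear_def)
    have d: "op_diff L K (fock_kernel w) \<in> fock_space q"
      unfolding op_diff_def
      by (rule fock_norm_triangle(1)[OF Lq _ q])
         (auto intro!: holomorphic_intros fock_spaceD[OF Lq(1)] fock_spaceD[OF Lq(2)] norm_triangle_ineq4)
    have "L (fock_kernel w) z = op_diff L K (fock_kernel w) z + K (fock_kernel w) z"
      by (simp add: op_diff_def)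
    then have "norm (L (fock_kernel w) z) * E \<le> norm (op_diff L K (fock_kernel w) z) * E + norm (K (fock_kernel w) z) * E"
      unfolding distrib_right[symmetric] using E by (metis mult_right_mono norm_triangle_ineq less_imp_le)
    also have "\<dots> \<le> fock_norm q (op_diff L K (fock_kernel w)) + fock_norm q (K (fock_kernel w))"
      unfolding E_def by (intro add_mono norm_le_fock_norm d Lq q)
    also have "fock_norm q (op_diff L K (fock_kernel w)) \<le> N"
      using order_trans[OF fock_op_norm_ge[OF kp] N] by simp
    finally show ?thesis by simp
  qed
  have W: "norm (weighted_comp \<psi> \<phi> (fock_kernel w) z) * E = m_fun \<psi> \<phi> z * exp (- ((norm (\<phi> z - w))\<^sup>2 / 2))" for \<psi> \<phi> w
    unfolding E_def norm_weighted_comp norm_fock_kernel ..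
  \<comment> \<open>At \<open>z\<close> the first operator sees the kernel at its peak
    \<open>\<phi>1 z\<close>, giving exactly m1, while the second sees it at distance |\<phi>1 z -
    \<phi>2 z| from the peak, giving m2 damped by \<open>x\<close>. The second estimate exchanges
    the roles.\<close>
  have "m_fun \<psi>1 \<phi>1 z - m_fun \<psi>2 \<phi>2 z * x
     = norm (weighted_comp \<psi>1 \<phi>1 (fock_kernel (\<phi>1 z)) z) * E - norm (weighted_comp \<psi>2 \<phi>2 (fock_kernel (\<phi>1 z)) z) * E"
    by (simp add: W x_def norm_minus_commute)
  also have "\<dots> \<le> norm (L (fock_kernel (\<phi>1 z)) z) * E"
    unfolding L_def op_diff_def left_diff_distrib[symmetric]
    using E by (intro mult_right_mono norm_triangle_ineq2) simp
  also note Lk[of "\<phi>1 z"]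
  finally have 1: "m_fun \<psi>1 \<phi>1 z - m_fun \<psi>2 \<phi>2 z * x \<le> N + fock_norm q (K (fock_kernel (\<phi>1 z)))" .
  have "m_fun \<psi>2 \<phi>2 z - m_fun \<psi>1 \<phi>1 z * x
     = norm (weighted_comp \<psi>2 \<phi>2 (fock_kernel (\<phi>2 z)) z) * E - norm (weighted_comp \<psi>1 \<phi>1 (fock_kernel (\<phi>2 z)) z) * E"
    by (simp add: W x_def)
  also have "\<dots> \<le> norm (L (fock_kernel (\<phi>2 z)) z) * E"
    unfolding L_def op_diff_def left_diff_distrib[symmetric]
    using E by (subst norm_minus_commute, intro mult_right_mono norm_triangle_ineq2) simp
  also note Lk[of "\<phi>2 z"]
  finally have 2: "m_fun \<psi>2 \<phi>2 z - m_fun \<psi>1 \<phi>1 z * x \<le> N + fock_norm q (K (fock_kernel (\<phi>2 z)))" .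
  from 1 2 show ?thesis by (simp add: algebra_simps flip: x_def)
qed

lemma filterlim_affine_at_infinity:
  fixes a b :: complex
  assumes "a \<noteq> 0"
  shows "filterlim (\<lambda>z. a * z + b) at_infinity at_infinity"
  using tendsto_add_filterlim_at_infinity'[OF tendsto_mult_filterlim_at_infinity[OF tendsto_const assms filterlim_ident] tendsto_const]
  by simp

lemma one_minus_exp_ge: "x / (1 + x) \<le> 1 - exp (- x)" if "x \<ge> 0" for x :: real
proof -
  have "exp (- x) \<le> 1 / (1 + x)"
    using exp_ge_add_one_self[of x] that by (simp add: exp_minus field_simps)
  also have "1 / (1 + x) = 1 - x / (1 + x)" using that by (simp add: field_simps)
  finally show ?thesis by simp
qed

text \<open>With equal slopes the symbols differ by the constant b1 - b2, and x/(1+x) at x = |b1 -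
  b2|^2/2 is exactly twice \<open>rho\<close>. With different slopes their distance tends to
  infinity, so every c < 1 is eventually exceeded.\<close>

lemma eventually_separation_ge:
  fixes a1 a2 b1 b2 :: complex
  assumes "c < 2 * alpha a1 b1 a2 b2"
  shows "eventually (\<lambda>z. c \<le> 1 - exp (- ((norm ((a1 * z + b1) - (a2 * z + b2)))\<^sup>2 / 2))) at_infinity"
proof (cases "a1 = a2")
  case True
  define d where "d = (norm (b1 - b2))\<^sup>2"
  have d: "d \<ge> 0" by (simp add: d_def)
  have "2 * (d / (2 * (2 + d))) = d / (2 + d)"
    by (simp only: times_divide_eq_right mult_divide_mult_cancel_left_if) simp
  then have "c \<le> d / (2 + d)" using assms True by (simp only: alpha_def rho_def d_def) simp
  also have "d / (2 + d) = (d / 2) / (1 + d / 2)" using d by (simp add: field_simps)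
  also have "\<dots> \<le> 1 - exp (- (d / 2))" by (rule one_minus_exp_ge) (use d in simp)
  finally show ?thesis using True by (simp add: d_def)
next
  case False
  then have c: "c < 1" using assms by (simp add: alpha_def)
  \<comment> \<open>For x >= \<open>B\<close> one has x^2/2 >= x/2 >= 1/(1-c), which forces the
    fraction (x^2/2)/(1 + x^2/2) to be at least \<open>c\<close>.\<close>
  define B where "B = max 1 (2 / (1 - c))"
  have "filterlim (\<lambda>z. norm ((a1 - a2) * z + (b1 - b2))) at_top at_infinity"
    using False by (intro filterlim_at_infinity_imp_norm_at_top filterlim_affine_at_infinity) auto
  then have "eventually (\<lambda>z. B \<le> norm ((a1 - a2) * z + (b1 - b2))) at_infinity"
    by (simp add: filterlim_at_top)
  then show ?thesis
  proof eventually_elim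
    case (elim z)
    define x where "x = norm ((a1 - a2) * z + (b1 - b2))"
    have x: "x \<ge> 1" "x \<ge> 2 / (1 - c)" using elim by (auto simp: x_def B_def)
    then have "x * 1 \<le> x * x" by (intro mult_left_mono) auto
    then have y: "1 / (1 - c) \<le> x\<^sup>2 / 2" using x(2) by (simp add: power2_eq_square)
    have "1 \<le> (1 - c) * (x\<^sup>2 / 2)" using y c by (simp add: pos_divide_le_eq mult.commute)
    then have "c * (1 + x\<^sup>2 / 2) \<le> x\<^sup>2 / 2" using c by (simp add: algebra_simps)
    moreover have "0 < 1 + x\<^sup>2 / 2" by (simp add: add_pos_nonneg)
    ultimately have "c \<le> (x\<^sup>2 / 2) / (1 + x\<^sup>2 / 2)" by (simp only: pos_le_divide_eq)
    also have "\<dots> \<le> 1 - exp (- (x\<^sup>2 / 2))" by (rule one_minus_exp_ge) simp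
    finally show ?case by (simp add: x_def algebra_simps)
  qed
qed

lemma alpha_pos:
  assumes "a1 \<noteq> a2 \<or> b1 \<noteq> b2"
  shows "alpha a1 b1 a2 b2 > 0"
  using assms by (auto simp: alpha_def rho_def intro!: divide_pos_pos add_pos_nonneg)

lemma essential_norm_lower_bound:
  fixes \<psi>1 \<psi>2 \<phi>1 \<phi>2 p q
  defines "L \<equiv> op_diff (weighted_comp \<psi>1 \<phi>1) (weighted_comp \<psi>2 \<phi>2)"
  assumes p: "p > 1" and q: "q \<ge> 1" and L: "fock_linear p q L"
    and \<phi>: "\<And>z. \<phi>1 z = a1 * z + b1" "\<And>z. \<phi>2 z = a2 * z + b2"
    and a: "a1 \<noteq> 0" "a2 \<noteq> 0" and ne: "a1 \<noteq> a2 \<or> b1 \<noteq> b2"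
  shows "ereal (alpha a1 b1 a2 b2) * Limsup at_infinity (\<lambda>z. ereal (m_fun \<psi>1 \<phi>1 z + m_fun \<psi>2 \<phi>2 z))
    \<le> fock_ess_norm p q L"
  unfolding fock_ess_norm_def
proof (rule INF_greatest)
  fix K assume "K \<in> {K. fock_compact p q K}"
  then have K: "fock_compact p q K" by simp
  then have Kl: "fock_linear p q K" by (simp add: fock_compact_def fock_bounded_linear_def)
  define A where "A = alpha a1 b1 a2 b2"
  define M where "M z = m_fun \<psi>1 \<phi>1 z + m_fun \<psi>2 \<phi>2 z" for z
  define X where "X = Limsup at_infinity (\<lambda>z. ereal (M z))"
  have A: "A > 0" using ne by (simp add: A_def alpha_pos)
  have M: "M z \<ge> 0" for z by (simp add: M_def)
  have X0: "X \<ge> 0" unfolding X_def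
    by (intro le_Limsup trivial_limit_at_infinity always_eventually) (use M in simp)
  \<comment> \<open>The unit ball contains \<open>fock_kernel 0\<close>, so the supremum is not
    minus infinity; with value infinity the claim is trivial, and a real \<open>N\<close>
    remains.\<close>
  have N0: "0 \<le> fock_op_norm p q (op_diff L K)"
    by (rule order_trans[OF _ fock_op_norm_ge[of "fock_kernel 0"]]) (use p fock_kernel_space in auto)
  show "ereal (alpha a1 b1 a2 b2) * Limsup at_infinity (\<lambda>z. ereal (m_fun \<psi>1 \<phi>1 z + m_fun \<psi>2 \<phi>2 z))
    \<le> fock_op_norm p q (op_diff L K)"
  proof (cases "fock_op_norm p q (op_diff L K)")
    case (real N)
    have Xle: "X \<le> ereal ((2 * N + e) / c)" if e: "e > 0" and c: "0 < c" "c < 2 * A" for e c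
    proof -
      have "e / 2 > 0" using e by simp
      note ev = compact_kernel_tendsto_0[OF K p q this]
      have ev1: "eventually (\<lambda>z. fock_norm q (K (fock_kernel (\<phi>1 z))) < e / 2) at_infinity"
        unfolding \<phi> by (rule eventually_compose_filterlim[OF ev filterlim_affine_at_infinity[OF a(1)]])
      have ev2: "eventually (\<lambda>z. fock_norm q (K (fock_kernel (\<phi>2 z))) < e / 2) at_infinity"
        unfolding \<phi> by (rule eventually_compose_filterlim[OF ev filterlim_affine_at_infinity[OF a(2)]])
      have "eventually (\<lambda>z. ereal (M z) \<le> ereal ((2 * N + e) / c)) at_infinity"
        using eventually_separation_ge[OF c(2)[unfolded A_def], folded \<phi>] ev1 ev2
      proof eventually_elim
        case (elim z)
        have "c * M z \<le> (1 - exp (- ((norm (\<phi>1 z - \<phi>2 z))\<^sup>2 / 2))) * M z"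
          by (intro mult_right_mono elim M)
        also have "\<dots> \<le> 2 * N + fock_norm q (K (fock_kernel (\<phi>1 z))) + fock_norm q (K (fock_kernel (\<phi>2 z)))"
          unfolding M_def by (rule op_diff_kernel_estimate[of p q]) (use L Kl p q real in \<open>auto simp: L_def\<close>)
        also have "\<dots> \<le> 2 * N + e" using elim by simp
        finally show ?case using c by (simp add: pos_le_divide_eq mult.commute)
      qed
      then show ?thesis unfolding X_def by (rule Limsup_bounded)
    qed
    \<comment> \<open>A crude choice of parameters shows first that the upper limit is finite. The
      sharp bound then follows for e tending to 0 and c = t * 2A with t tending to 1.\<close>
    from Xle[of 1 A] A have "X \<le> ereal ((2 * N + 1) / A)" by simp
    with X0 obtain x where x: "X = ereal x" by (cases X) auto
    have "2 * A * x \<le> 2 * N"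
    proof (rule field_le_epsilon)
      fix e :: real assume e: "e > 0"
      show "2 * A * x \<le> 2 * N + e"
      proof (rule field_le_mult_one_interval)
        fix t :: real assume t: "0 < t" "t < 1"
        have "x \<le> (2 * N + e) / (t * (2 * A))"
          using Xle[of e "t * (2 * A)"] e t A by (simp add: x)
        then show "t * (2 * A * x) \<le> 2 * N + e"
          using t A by (simp add: pos_le_divide_eq mult_ac)
      qed
    qed
    then show ?thesis using x real by (simp add: X_def M_def A_def)
  qed (use N0 in auto)
qed

section \<open>The upper bound\<close>

text \<open>Merges the contributions from outside and inside a disc: the q-th root of X^q + d^q is
  at most X + d.\<close>

lemma powr_superadditive:
  fixes x y q :: real
  assumes "x \<ge> 0" "y \<ge> 0" "q \<ge> 1"
  shows "x powr q + y powr q \<le> (x + y) powr q"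
proof -
  have split: "u powr q = u powr (q - 1) * u" if "u \<ge> 0" for u :: real
    using that by (cases "u = 0") (use powr_add[of u "q - 1" 1] in auto)
  have "x powr q + y powr q \<le> (x + y) powr (q - 1) * x + (x + y) powr (q - 1) * y"
    using assms unfolding split[OF assms(1)] split[OF assms(2)]
    by (intro add_mono mult_right_mono powr_mono2) auto
  also have "\<dots> = (x + y) powr q" using assms by (simp add: split flip: distrib_left)
  finally show ?thesis .
qed

text \<open>Mean value bound along the disc of radius \<open>R\<close>, with the derivative
  controlled by Cauchy's inequality on unit circles; this is why the growth bound is taken at radius
  R + 1. The estimate is uniform over the unit ball of the Fock space.\<close>

lemma dilation_diff_le:
  assumes f: "f \<in> fock_space p" "fock_norm p f \<le> 1" and p: "p \<ge> 1"
    and u: "norm u \<le> R" and r: "0 \<le> r" "r \<le> 1"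
  shows "norm (f u - f (of_real r * u)) \<le> (1 - r) * (R * exp ((R + 1)\<^sup>2 / 2))"
proof -
  define B where "B = exp ((R + 1)\<^sup>2 / 2)"
  have R: "R \<ge> 0" using u norm_ge_zero[of u] by linarith
  have holo: "f holomorphic_on UNIV" using f by (simp add: fock_spaceD)
  have fle: "norm (f z) \<le> B" if "norm z \<le> R + 1" for z
  proof -
    have "norm (f z) \<le> fock_norm p f * exp ((norm z)\<^sup>2 / 2)" by (rule norm_le_fock_norm'[OF f(1) p])
    also have "\<dots> \<le> 1 * B"
      unfolding B_def using f that R by (intro mult_mono) (auto intro!: power_mono)
    finally show ?thesis by simp
  qed
  have d: "norm (deriv f z) \<le> B" if "z \<in> cball 0 R" for z
  proof -
    have "norm ((deriv ^^ 1) f z) \<le> fact 1 * B / 1 ^ 1"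
    proof (rule Cauchy_inequality)
      show "f holomorphic_on ball z 1" using holo by (rule holomorphic_on_subset) simp
      show "continuous_on (cball z 1) f"
        using holo by (intro holomorphic_on_imp_continuous_on) (rule holomorphic_on_subset, auto)
      fix x assume "norm (z - x) = 1"
      moreover have "norm x \<le> norm z + norm (z - x)" by (metis norm_minus_commute norm_triangle_sub)
      ultimately show "norm (f x) \<le> B" using that by (intro fle) auto
    qed simp
    then show ?thesis by simp
  qed
  have "norm (f u - f (of_real r * u)) \<le> B * norm (u - of_real r * u)"
  proof (rule field_differentiable_bound[of "cball 0 R" f "deriv f"])
    show "(f has_field_derivative deriv f z) (at z within cball 0 R)" for z
      using holomorphic_derivI[OF holo, of z] by (simp add: has_field_derivative_at_within)
    show "of_real r * u \<in> cball 0 R"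
      using r u mult_left_le_one_le[of "norm u" r] by (auto simp: norm_mult)
  qed (use d u in auto)
  also have "u - of_real r * u = of_real (1 - r) * u" by (simp add: algebra_simps)
  also have "norm \<dots> = (1 - r) * norm u" using r by (simp add: norm_mult flip: of_real_diff)
  also have "B * ((1 - r) * norm u) \<le> B * ((1 - r) * R)"
    using r u by (intro mult_left_mono) (auto simp: B_def)
  finally show ?thesis by (simp add: B_def mult_ac)
qed

text \<open>Outside the disc \<open>m_fun\<close> is at most \<open>M\<close>, and the substitution
  by \<phi> contributes 1/|a|^2, the embedding q/p; inside, the image is at most \<open>d\<close>
  and the Gaussian has the mass that normalises to one. Both nonnegative bounds are added for every
  \<open>z\<close>, so no indicator functions appear.\<close>

lemma weighted_comp_fock_norm_le:
  assumes p: "1 \<le> p" "p \<le> q" and \<psi>: "\<psi> holomorphic_on UNIV" and \<phi>: "\<And>z. \<phi> z = a * z + b" and a: "a \<noteq> 0"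
    and g: "g \<in> fock_space p" "fock_norm p g \<le> G"
    and M: "M \<ge> 0" "\<And>z. norm z \<ge> R \<Longrightarrow> m_fun \<psi> \<phi> z \<le> M"
    and d: "d \<ge> 0" "\<And>z. norm z \<le> R \<Longrightarrow> norm (weighted_comp \<psi> \<phi> g z) \<le> d"
  shows "weighted_comp \<psi> \<phi> g \<in> fock_space q"
    and "fock_norm q (weighted_comp \<psi> \<phi> g) \<le> (q / (p * (norm a)\<^sup>2)) powr (1 / q) * M * G + d"
proof -
  define h where "h = weighted_comp \<psi> \<phi> g"
  define X where "X = (q / (p * (norm a)\<^sup>2)) powr (1 / q) * M * G"
  have q: "q \<ge> 1" using p by simp
  have G: "G \<ge> 0" using g(2) fock_norm_nonneg[of p g] by linarith
  have X: "X \<ge> 0" using M G by (simp add: X_def)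
  have g0: "g holomorphic_on UNIV" using g by (simp add: fock_spaceD)
  have h: "h holomorphic_on UNIV"
    unfolding h_def weighted_comp_def \<phi> by (intro holomorphic_intros \<psi> holomorphic_compose_affine g0)
  note [measurable] = borel_measurable_fock_density[OF g0]
  have pt: "fock_density q h z \<le> M powr q * fock_density q g (a * z + b) + d powr q * exp (- (q * (norm (z - 0))\<^sup>2 / 2))" for z
  proof (cases "norm z \<ge> R")
    case True
    have "fock_density q h z = (m_fun \<psi> \<phi> z) powr q * fock_density q g (\<phi> z)"
      unfolding fock_density_eq h_def norm_weighted_comp by (rule powr_mult)
    also have "\<dots> \<le> M powr q * fock_density q g (\<phi> z)"
      using M(2)[OF True] q by (intro mult_right_mono powr_mono2) auto
    finally show ?thesis by (simp add: \<phi> add_increasing2)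
  next
    case False
    then have "fock_density q h z \<le> d powr q * exp (- (q * (norm z)\<^sup>2 / 2))"
      unfolding fock_density_def h_def using d(2)[of z] q by (intro mult_right_mono powr_mono2) auto
    then show ?thesis by (simp add: add_increasing)
  qed
  have "fock_nn q h \<le> (\<integral>\<^sup>+z. ennreal (M powr q) * ennreal (fock_density q g (a * z + b))
      + ennreal (d powr q) * ennreal (exp (- (q * (norm (z - 0))\<^sup>2 / 2))) \<partial>lborel)"
    unfolding fock_nn_def using pt
    by (intro nn_integral_mono) (simp flip: ennreal_mult ennreal_plus)
  also have "\<dots> = ennreal (M powr q) * (\<integral>\<^sup>+z. ennreal (fock_density q g (a * z + b)) \<partial>lborel)
      + ennreal (d powr q) * (\<integral>\<^sup>+z. ennreal (exp (- (q * (norm (z - 0))\<^sup>2 / 2))) \<partial>(lborel :: complex measure))"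
    by (subst nn_integral_add) (auto simp: nn_integral_cmult)
  also have "(\<integral>\<^sup>+z. ennreal (fock_density q g (a * z + b)) \<partial>lborel) = ennreal (1 / (norm a)\<^sup>2) * fock_nn q g"
    unfolding fock_nn_def using a by (intro nn_integral_complex_affine) auto
  also have "(\<integral>\<^sup>+z. ennreal (exp (- (q * (norm (z - 0))\<^sup>2 / 2))) \<partial>(lborel :: complex measure)) = ennreal (2 * pi / q)"
    using q by (intro nn_integral_gaussian_fock) auto
  also have "ennreal (M powr q) * (ennreal (1 / (norm a)\<^sup>2) * fock_nn q g) + ennreal (d powr q) * ennreal (2 * pi / q)
     \<le> ennreal (M powr q) * (ennreal (1 / (norm a)\<^sup>2) * ennreal (2 * pi / p * G powr q)) + ennreal (d powr q) * ennreal (2 * pi / q)"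
  proof (intro add_mono mult_left_mono order_refl)
    have "fock_nn q g \<le> ennreal (2 * pi / p * fock_norm p g powr q)"
      by (rule fock_embedding[OF g(1) p])
    also have "\<dots> \<le> ennreal (2 * pi / p * G powr q)"
      using p g(2) by (intro ennreal_leI mult_left_mono powr_mono2) auto
    finally show "fock_nn q g \<le> ennreal (2 * pi / p * G powr q)" .
  qed auto
  also have "\<dots> = ennreal (M powr q * (1 / (norm a)\<^sup>2 * (2 * pi / p * G powr q)) + d powr q * (2 * pi / q))"
    using p q by (simp flip: ennreal_mult ennreal_plus)
  also have "M powr q * (1 / (norm a)\<^sup>2 * (2 * pi / p * G powr q)) + d powr q * (2 * pi / q)
     = 2 * pi / q * (X powr q + d powr q)"
  proof -
    have "X powr q = q / (p * (norm a)\<^sup>2) * M powr q * G powr q"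
      using p q by (simp add: X_def powr_mult powr_powr)
    then show ?thesis using p q a by (simp add: field_simps)
  qed
  also have "ennreal \<dots> \<le> ennreal (2 * pi / q * (X + d) powr q)"
    using X d q by (intro ennreal_leI mult_left_mono powr_superadditive) auto
  finally have le: "fock_nn q h \<le> ennreal (2 * pi / q * (X + d) powr q)" .
  show "h \<in> fock_space q" "fock_norm q h \<le> X + d"
    by (rule fock_space_normI[OF h _ _ le]; use X d q in simp)+
qed

text \<open>The disc is chosen first, from the upper limit alone, and only then \<open>r\<close>
  close enough to 1 to make the image small on it. The bound holds for all r from \<open>r0\<close>
  on, so that two symbols can share one dilation.\<close>

lemma weighted_comp_dilation_estimate:
  assumes p: "1 \<le> p" "p \<le> q" and \<psi>: "\<psi> holomorphic_on UNIV" and \<phi>: "\<And>z. \<phi> z = a * z + b" and a: "a \<noteq> 0"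
    and l: "Limsup at_infinity (\<lambda>z. ereal (m_fun \<psi> \<phi> z)) = ereal l" and e: "e > 0"
  obtains r0 where "0 \<le> r0" "r0 < 1"
    and "\<And>r f. \<lbrakk>r0 \<le> r; r < 1; f \<in> fock_space p; fock_norm p f \<le> 1\<rbrakk> \<Longrightarrow>
        weighted_comp \<psi> \<phi> (\<lambda>z. f z - f (of_real r * z)) \<in> fock_space q \<and>
        fock_norm q (weighted_comp \<psi> \<phi> (\<lambda>z. f z - f (of_real r * z)))
          \<le> (q / (p * (norm a)\<^sup>2)) powr (1 / q) * (l + e) * 2 + e"
proof -
  have "ereal 0 \<le> ereal l"
    unfolding l[symmetric] by (intro le_Limsup trivial_limit_at_infinity always_eventually) simp
  then have l0: "l \<ge> 0" by simp
  have "eventually (\<lambda>z. ereal (m_fun \<psi> \<phi> z) < ereal (l + e)) at_infinity"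
    by (rule Limsup_lessD) (use l e in simp)
  then obtain R0 where R0: "\<And>z. norm z \<ge> R0 \<Longrightarrow> m_fun \<psi> \<phi> z < l + e"
    by (auto simp: eventually_at_infinity)
  define R where "R = max R0 0"
  have "continuous_on (cball 0 R) \<psi>"
    using \<psi> by (intro holomorphic_on_imp_continuous_on) (rule holomorphic_on_subset, auto)
  then have "bounded (\<psi> ` cball 0 R)"
    by (intro compact_imp_bounded compact_continuous_image) auto
  then obtain B where B: "B > 0" "\<And>z. norm z \<le> R \<Longrightarrow> norm (\<psi> z) \<le> B"
    by (auto simp: bounded_pos)
  define R' where "R' = norm a * R + norm b"
  have R': "R' \<ge> 0" by (simp add: R'_def R_def)
  define C where "C = B * (R' * exp ((R' + 1)\<^sup>2 / 2))"
  have C: "C \<ge> 0" using B R' by (simp add: C_def)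
  \<comment> \<open>Chosen so that (1 - r) C <= e; using C + 1 avoids division by zero, and the
    maximum keeps \<open>r0\<close> nonnegative for large \<open>e\<close>.\<close>
  define r0 where "r0 = max 0 (1 - e / (C + 1))"
  show ?thesis
  proof (rule that[of r0])
    show "0 \<le> r0" "r0 < 1" using e C by (auto simp: r0_def)
    fix r f assume r: "r0 \<le> r" "r < 1" and f: "f \<in> fock_space p" "fock_norm p f \<le> 1"
    define g where "g z = f z - f (of_real r * z)" for z
    have r0: "0 \<le> r" using r by (simp add: r0_def)
    note fr = fock_dilation[OF f(1) r0 r(2) p(1)]
    have gh: "g holomorphic_on UNIV"
      unfolding g_def by (intro holomorphic_intros fock_spaceD[OF f(1)] fock_spaceD[OF fr(1)])
    have g: "g \<in> fock_space p" "fock_norm p g \<le> fock_norm p f + fock_norm p (\<lambda>z. f (of_real r * z))"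
      by (rule fock_norm_triangle[OF f(1) fr(1) gh p(1)]; simp add: g_def norm_triangle_ineq4)+
    then have g2: "fock_norm p g \<le> 2" using fr(2) f(2) by linarith
    have "1 - e / (C + 1) \<le> r" using r by (simp add: r0_def)
    then have "(1 - r) * (C + 1) \<le> e" using C by (simp add: field_simps)
    moreover have "(1 - r) * C \<le> (1 - r) * (C + 1)" using r by (intro mult_left_mono) auto
    ultimately have small: "(1 - r) * C \<le> e" by linarith
    have d: "norm (weighted_comp \<psi> \<phi> g z) \<le> e" if z: "norm z \<le> R" for z
    proof -
      have "norm (\<phi> z) \<le> R'"
        unfolding \<phi> R'_def using z by (intro order_trans[OF norm_triangle_ineq] add_mono) (auto simp: norm_mult mult_left_mono)
      then have "norm (g (\<phi> z)) \<le> (1 - r) * (R' * exp ((R' + 1)\<^sup>2 / 2))"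
        unfolding g_def using r r0 by (intro dilation_diff_le[OF f p(1)]) auto
      then have "norm (\<psi> z) * norm (g (\<phi> z)) \<le> B * ((1 - r) * (R' * exp ((R' + 1)\<^sup>2 / 2)))"
        using B z by (intro mult_mono) auto
      also have "\<dots> = (1 - r) * C" by (simp add: C_def)
      also note small
      finally show ?thesis by (simp add: weighted_comp_def norm_mult)
    qed
    have M: "m_fun \<psi> \<phi> z \<le> l + e" if "norm z \<ge> R" for z
      using R0[of z] that by (simp add: R_def)
    have "weighted_comp \<psi> \<phi> g \<in> fock_space q \<and>
        fock_norm q (weighted_comp \<psi> \<phi> g) \<le> (q / (p * (norm a)\<^sup>2)) powr (1 / q) * (l + e) * 2 + e"
      by (intro conjI weighted_comp_fock_norm_le[OF p \<psi> \<phi> a g(1) g2 _ M _ d]) (use l0 e in auto)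
    then show "weighted_comp \<psi> \<phi> (\<lambda>z. f z - f (of_real r * z)) \<in> fock_space q \<and>
        fock_norm q (weighted_comp \<psi> \<phi> (\<lambda>z. f z - f (of_real r * z)))
          \<le> (q / (p * (norm a)\<^sup>2)) powr (1 / q) * (l + e) * 2 + e"
      by (simp add: g_def[abs_def])
  qed
qed

section \<open>Compactness of dilations\<close>

lemma dilation_growth:
  assumes g: "\<And>z. norm (g z) \<le> C * exp ((norm z)\<^sup>2 / 2)" and C: "C \<ge> 0" and p: "p > 0" and r: "0 \<le> r"
  shows "fock_density p (\<lambda>z. g (of_real r * z)) z \<le> C powr p * exp (- (p * (1 - r\<^sup>2) / 2 * (norm z)\<^sup>2))"
proof -
  have "norm (g (of_real r * z)) * exp (- ((norm z)\<^sup>2 / 2)) \<le> C * exp ((norm (of_real r * z))\<^sup>2 / 2) * exp (- ((norm z)\<^sup>2 / 2))"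
    by (intro mult_right_mono g) simp
  also have "\<dots> = C * exp (- ((1 - r\<^sup>2) / 2 * (norm z)\<^sup>2))"
  proof -
    have "(norm (of_real r * z))\<^sup>2 / 2 + - ((norm z)\<^sup>2 / 2) = - ((1 - r\<^sup>2) / 2 * (norm z)\<^sup>2)"
      by (simp add: norm_mult power_mult_distrib field_simps)
    then show ?thesis by (simp only: mult.assoc flip: exp_add)
  qed
  finally have "fock_density p (\<lambda>z. g (of_real r * z)) z \<le> (C * exp (- ((1 - r\<^sup>2) / 2 * (norm z)\<^sup>2))) powr p"
    unfolding fock_density_eq using p by (intro powr_mono2) auto
  also have "\<dots> = C powr p * exp (- (p * (1 - r\<^sup>2) / 2 * (norm z)\<^sup>2))"
    by (simp add: powr_mult exp_powr_real mult_ac)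
  finally show ?thesis .
qed

lemma integrable_gaussian_complex:
  assumes "c > 0"
  shows "integrable (lborel :: complex measure) (\<lambda>z. exp (- (c * (norm z)\<^sup>2)))"
  by (rule integrableI_bounded) (use nn_integral_gaussian_complex[OF assms] in auto)

lemma fock_space_dilation_growth:
  assumes g: "\<And>z. norm (g z) \<le> C * exp ((norm z)\<^sup>2 / 2)" and C: "C \<ge> 0" and p: "p > 0" and r: "0 \<le> r" "r < 1"
    and holo: "g holomorphic_on UNIV"
  shows "(\<lambda>z. g (of_real r * z)) \<in> fock_space p"
proof -
  have h: "(\<lambda>z. g (of_real r * z)) holomorphic_on UNIV"
    using holomorphic_compose_affine[OF holo, of "of_real r" 0] by simp
  have c: "p * (1 - r\<^sup>2) / 2 > 0" using p r by (simp add: power_less_one_iff abs_square_less_1)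
  have "integrable lborel (fock_density p (\<lambda>z. g (of_real r * z)))"
  proof (rule Bochner_Integration.integrable_bound)
    show "integrable lborel (\<lambda>z::complex. C powr p * exp (- (p * (1 - r\<^sup>2) / 2 * (norm z)\<^sup>2)))"
      by (intro integrable_mult_right integrable_gaussian_complex c)
    show "fock_density p (\<lambda>z. g (of_real r * z)) \<in> borel_measurable lborel"
      using borel_measurable_fock_density[OF h] by simp
  qed (use dilation_growth[OF g C p r(1)] in auto)
  with h show ?thesis by (simp add: fock_space_def)
qed

text \<open>Montel's theorem gives locally uniform limits; after a dilation the Gaussian weight wins by a
  factor \<open>exp (- p * (1 - r\<^sup>2) * (norm z)\<^sup>2 / 2)\<close>, so dominated convergence upgrades them to norm limits.\<close>

lemma dilation_sequentially_compact:
  assumes p: "p \<ge> 1" and r: "0 \<le> r" "r < 1"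
    and f: "\<And>n. f n \<in> fock_space p" "\<And>n. fock_norm p (f n) \<le> C"
  obtains s g where "strict_mono (s :: nat \<Rightarrow> nat)" "(\<lambda>z. g (of_real r * z)) \<in> fock_space p"
    "\<And>n. (\<lambda>z. f (s n) (of_real r * z) - g (of_real r * z)) \<in> fock_space p"
    "(\<lambda>n. fock_norm p (\<lambda>z. f (s n) (of_real r * z) - g (of_real r * z))) \<longlonglongrightarrow> 0"
proof -
  have C: "C \<ge> 0" using f(2)[of 0] fock_norm_nonneg[of p "f 0"] by linarith
  have growth: "norm (f n z) \<le> C * exp ((norm z)\<^sup>2 / 2)" for n z
    by (rule order_trans[OF norm_le_fock_norm'[OF f(1) p]]) (intro mult_right_mono f, simp)
  define H where "H = {h. h holomorphic_on UNIV \<and> (\<forall>z. norm (h z) \<le> C * exp ((norm z)\<^sup>2 / 2))}"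
  obtain g s where g: "g holomorphic_on UNIV" and s: "strict_mono (s :: nat \<Rightarrow> nat)"
    and lim: "\<And>z. (\<lambda>n. f (s n) z) \<longlonglongrightarrow> g z"
  proof (rule Montel[of UNIV H f])
    show "\<exists>B. \<forall>h\<in>H. \<forall>z\<in>K. norm (h z) \<le> B" if K: "compact K" for K
    proof -
      obtain b where b: "\<And>z. z \<in> K \<Longrightarrow> norm z \<le> b"
        using compact_imp_bounded[OF K] by (auto simp: bounded_iff)
      have "norm (h z) \<le> C * exp (b\<^sup>2 / 2)" if "h \<in> H" "z \<in> K" for h z
      proof -
        have "norm (h z) \<le> C * exp ((norm z)\<^sup>2 / 2)" using that by (simp add: H_def)
        also have "\<dots> \<le> C * exp (b\<^sup>2 / 2)"
          using b[OF that(2)] C by (intro mult_left_mono) (auto intro: power_mono)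
        finally show ?thesis .
      qed
      then show ?thesis by blast
    qed
    show "range f \<subseteq> H" using fock_spaceD[OF f(1)] growth by (auto simp: H_def)
    fix g s
    assume "g holomorphic_on UNIV" "strict_mono (s :: nat \<Rightarrow> nat)"
      "\<And>z. z \<in> UNIV \<Longrightarrow> (\<lambda>n. f (s n) z) \<longlonglongrightarrow> g z"
    then show thesis by (intro that[of g s]) auto
  qed (auto simp: H_def)
  \<comment> \<open>The limit inherits the growth bound, which already puts its dilation into the
    Fock space and, doubled, dominates the differences.\<close>
  have gg: "norm (g z) \<le> C * exp ((norm z)\<^sup>2 / 2)" for z
    by (rule tendsto_upperbound[OF tendsto_norm[OF lim]]) (auto simp: growth)
  have p0: "p > 0" using p by simp
  note gp = fock_space_dilation_growth[OF gg C p0 r g]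
  define h where "h n z = f (s n) z - g z" for n z
  have hh: "h n holomorphic_on UNIV" for n
    unfolding h_def by (intro holomorphic_intros fock_spaceD[OF f(1)] g)
  have hg: "norm (h n z) \<le> (2 * C) * exp ((norm z)\<^sup>2 / 2)" for n z
    using norm_triangle_ineq4[of "f (s n) z" "g z"] growth[of "s n" z] gg[of z] by (simp add: h_def)
  have C2: "2 * C \<ge> 0" using C by simp
  have hp: "(\<lambda>z. h n (of_real r * z)) \<in> fock_space p" for n
    by (rule fock_space_dilation_growth[OF hg C2 p0 r hh])
  have c: "p * (1 - r\<^sup>2) / 2 > 0" using p r by (simp add: power_less_one_iff abs_square_less_1)
  have dg: "fock_density p (\<lambda>z. h n (of_real r * z)) z \<le> (2 * C) powr p * exp (- (p * (1 - r\<^sup>2) / 2 * (norm z)\<^sup>2))" for n z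
    by (rule dilation_growth[of "h n", OF hg C2 p0 r(1)])
  have "(\<lambda>n. LINT z|lborel. fock_density p (\<lambda>z. h n (of_real r * z)) z) \<longlonglongrightarrow> (LINT z|(lborel :: complex measure). 0)"
  proof (rule integral_dominated_convergence)
    show "integrable lborel (\<lambda>z::complex. (2 * C) powr p * exp (- (p * (1 - r\<^sup>2) / 2 * (norm z)\<^sup>2)))"
      by (intro integrable_mult_right integrable_gaussian_complex c)
    show "(\<lambda>z. fock_density p (\<lambda>z. h n (of_real r * z)) z) \<in> borel_measurable lborel" for n
      using borel_measurable_fock_density[OF fock_spaceD[OF hp]] by simp
    show "AE z in lborel. (\<lambda>n. fock_density p (\<lambda>z. h n (of_real r * z)) z) \<longlonglongrightarrow> 0"
    proof (rule AE_I2)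
      fix z :: complex
      have "(\<lambda>n. norm (h n (of_real r * z))) \<longlonglongrightarrow> 0"
        unfolding h_def using lim[of "of_real r * z"] by (intro tendsto_norm_zero) (simp add: LIM_zero)
      then have "(\<lambda>n. norm (h n (of_real r * z)) powr p * exp (- (p * (norm z)\<^sup>2 / 2))) \<longlonglongrightarrow> 0 powr p * exp (- (p * (norm z)\<^sup>2 / 2))"
        using p by (intro tendsto_intros) auto
      then show "(\<lambda>n. fock_density p (\<lambda>z. h n (of_real r * z)) z) \<longlonglongrightarrow> 0"
        by (simp add: fock_density_def)
    qed
  qed (use dg in auto)
  then have "(\<lambda>n. fock_norm p (\<lambda>z. h n (of_real r * z))) \<longlonglongrightarrow> (p / (2 * pi) * (LINT z|(lborel :: complex measure). 0)) powr (1 / p)"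
    unfolding fock_norm_def using p by (intro tendsto_powr' tendsto_mult tendsto_const) (auto intro: integral_nonneg_AE)
  then have "(\<lambda>n. fock_norm p (\<lambda>z. h n (of_real r * z))) \<longlonglongrightarrow> 0" by simp
  with s gp hp show ?thesis by (intro that[of s g]) (auto simp: h_def)
qed

text \<open>The dilation turns a bounded sequence into one with a norm convergent subsequence, and
  the bounded \<open>L\<close> carries this convergence to the target space.\<close>

lemma fock_compact_dilation:
  assumes L: "fock_bounded_linear p q L" and p: "p \<ge> 1" and r: "0 \<le> r" "r < 1"
  shows "fock_compact p q (\<lambda>f. L (\<lambda>z. f (of_real r * z)))"
proof -
  note D = fock_dilation[OF _ r p]
  have lin: "fock_linear p q L" using L by (simp add: fock_bounded_linear_def)
  then have add: "L (\<lambda>z. f z + g z) = (\<lambda>z. L f z + L g z)" if "f \<in> fock_space p" "g \<in> fock_space p" for f g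
    using that by (simp add: fock_linear_def)
  obtain C where C: "\<And>f. f \<in> fock_space p \<Longrightarrow> fock_norm q (L f) \<le> C * fock_norm p f"
    using L by (auto simp: fock_bounded_linear_def)
  \<comment> \<open>\<open>C\<close> has no known sign; the absolute value makes multiplication by
    it monotone.\<close>
  have C': "fock_norm q (L f) \<le> \<bar>C\<bar> * fock_norm p f" if "f \<in> fock_space p" for f
    by (rule order_trans[OF C[OF that]]) (intro mult_right_mono, auto)
  have "fock_norm q (L (\<lambda>z. f (of_real r * z))) \<le> \<bar>C\<bar> * fock_norm p f" if f: "f \<in> fock_space p" for f
    by (rule order_trans[OF C'[OF D(1)[OF f]]]) (intro mult_left_mono D f, simp)
  then have "fock_bounded_linear p q (\<lambda>f. L (\<lambda>z. f (of_real r * z)))"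
    unfolding fock_bounded_linear_def using lin D(1) by (auto simp: fock_linear_def)
  moreover have "\<exists>s g. strict_mono s \<and> g \<in> fock_space q \<and>
      (\<lambda>n. fock_norm q (\<lambda>z. L (\<lambda>z. f (s n) (of_real r * z)) z - g z)) \<longlonglongrightarrow> 0"
    if f: "\<And>n. f n \<in> fock_space p" "\<And>n. fock_norm p (f n) \<le> B" for f :: "nat \<Rightarrow> complex \<Rightarrow> complex" and B
  proof -
    obtain s g where s: "strict_mono (s :: nat \<Rightarrow> nat)" and g: "(\<lambda>z. g (of_real r * z)) \<in> fock_space p"
      and h: "\<And>n. (\<lambda>z. f (s n) (of_real r * z) - g (of_real r * z)) \<in> fock_space p"
      and lim: "(\<lambda>n. fock_norm p (\<lambda>z. f (s n) (of_real r * z) - g (of_real r * z))) \<longlonglongrightarrow> 0"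
      using dilation_sequentially_compact[where f = f, OF p r f] by blast
    \<comment> \<open>Additivity is applied to the dilated function written as (difference) +
      (dilated limit).\<close>
    have eq: "(\<lambda>z. L (\<lambda>z. f (s n) (of_real r * z)) z - L (\<lambda>z. g (of_real r * z)) z)
        = L (\<lambda>z. f (s n) (of_real r * z) - g (of_real r * z))" for n
      using add[OF h[of n] g] by (simp add: fun_eq_iff)
    have "(\<lambda>n. fock_norm q (\<lambda>z. L (\<lambda>z. f (s n) (of_real r * z)) z - L (\<lambda>z. g (of_real r * z)) z)) \<longlonglongrightarrow> 0"
      unfolding eq
    proof (rule tendsto_sandwich[OF _ _ tendsto_const])
      show "(\<lambda>n. \<bar>C\<bar> * fock_norm p (\<lambda>z. f (s n) (of_real r * z) - g (of_real r * z))) \<longlonglongrightarrow> 0"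
        using tendsto_mult_left[OF lim, of "\<bar>C\<bar>"] by simp
    qed (use C'[OF h] in auto)
    moreover have "L (\<lambda>z. g (of_real r * z)) \<in> fock_space q" using lin g by (simp add: fock_linear_def)
    ultimately show ?thesis using s by blast
  qed
  ultimately show ?thesis unfolding fock_compact_def by blast
qed

lemma essential_norm_upper_bound:
  fixes \<psi>1 \<psi>2 \<phi>1 \<phi>2 p q
  defines "L \<equiv> op_diff (weighted_comp \<psi>1 \<phi>1) (weighted_comp \<psi>2 \<phi>2)"
  assumes p: "1 \<le> p" "p \<le> q" and L: "fock_bounded_linear p q L"
    and \<psi>: "\<psi>1 holomorphic_on UNIV" "\<psi>2 holomorphic_on UNIV"
    and \<phi>: "\<And>z. \<phi>1 z = a1 * z + b1" "\<And>z. \<phi>2 z = a2 * z + b2" and a: "a1 \<noteq> 0" "a2 \<noteq> 0"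
  shows "fock_ess_norm p q L
    \<le> ereal (2 * (q / (p * (norm a1)\<^sup>2)) powr (1 / q)) * Limsup at_infinity (\<lambda>z. ereal (m_fun \<psi>1 \<phi>1 z))
      + ereal (2 * (q / (p * (norm a2)\<^sup>2)) powr (1 / q)) * Limsup at_infinity (\<lambda>z. ereal (m_fun \<psi>2 \<phi>2 z))"
proof -
  define c1 where "c1 = (q / (p * (norm a1)\<^sup>2)) powr (1 / q)"
  define c2 where "c2 = (q / (p * (norm a2)\<^sup>2)) powr (1 / q)"
  define X1 where "X1 = Limsup at_infinity (\<lambda>z. ereal (m_fun \<psi>1 \<phi>1 z))"
  define X2 where "X2 = Limsup at_infinity (\<lambda>z. ereal (m_fun \<psi>2 \<phi>2 z))"
  have q: "q \<ge> 1" using p by simp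
  have c: "c1 > 0" "c2 > 0" using p a by (auto simp: c1_def c2_def)
  have X: "X1 \<ge> 0" "X2 \<ge> 0" unfolding X1_def X2_def
    by (auto intro!: le_Limsup trivial_limit_at_infinity always_eventually)
  have "fock_ess_norm p q L \<le> ereal (2 * c1) * X1 + ereal (2 * c2) * X2"
  \<comment> \<open>Both coefficients are positive and both limits nonnegative, so an infinite upper
    limit makes the right side infinite.\<close>
  proof (cases "X1 = \<infinity> \<or> X2 = \<infinity>")
    case True
    have "ereal (2 * c1) * X1 \<ge> 0" "ereal (2 * c2) * X2 \<ge> 0" using c X by auto
    with True c have inf: "ereal (2 * c1) * X1 + ereal (2 * c2) * X2 = \<infinity>" by auto
    show ?thesis unfolding inf by simp
  next
    case False
    with X obtain x1 x2 where x1: "X1 = ereal x1" and x2: "X2 = ereal x2"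
      by (cases X1; cases X2) auto
    show ?thesis
    proof (rule ereal_le_epsilon2)
      fix e :: real assume e: "0 < e"
      \<comment> \<open>The budget: each operator loses 2 c d from replacing its upper limit by a
        larger value and d from the disc; together this is exactly \<open>e\<close>.\<close>
      define d where "d = e / (2 * c1 + 2 * c2 + 2)"
      have d: "d > 0" using e c by (simp add: d_def add_pos_pos)
      have de: "2 * c1 * d + 2 * c2 * d + 2 * d = e"
        using c add_pos_pos[of "c1" "c2"] by (simp add: d_def flip: distrib_right add_divide_distrib)
      obtain s1 where s1: "0 \<le> s1" "s1 < 1" "\<And>r f. \<lbrakk>s1 \<le> r; r < 1; f \<in> fock_space p; fock_norm p f \<le> 1\<rbrakk> \<Longrightarrow>
        weighted_comp \<psi>1 \<phi>1 (\<lambda>z. f z - f (of_real r * z)) \<in> fock_space q \<and>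
        fock_norm q (weighted_comp \<psi>1 \<phi>1 (\<lambda>z. f z - f (of_real r * z))) \<le> c1 * (x1 + d) * 2 + d"
        using weighted_comp_dilation_estimate[OF p \<psi>(1) \<phi>(1) a(1) x1[unfolded X1_def] d] unfolding c1_def by blast
      obtain s2 where s2: "0 \<le> s2" "s2 < 1" "\<And>r f. \<lbrakk>s2 \<le> r; r < 1; f \<in> fock_space p; fock_norm p f \<le> 1\<rbrakk> \<Longrightarrow>
        weighted_comp \<psi>2 \<phi>2 (\<lambda>z. f z - f (of_real r * z)) \<in> fock_space q \<and>
        fock_norm q (weighted_comp \<psi>2 \<phi>2 (\<lambda>z. f z - f (of_real r * z))) \<le> c2 * (x2 + d) * 2 + d"
        using weighted_comp_dilation_estimate[OF p \<psi>(2) \<phi>(2) a(2) x2[unfolded X2_def] d] unfolding c2_def by blast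
      define r where "r = max s1 s2"
      have r: "0 \<le> r" "r < 1" "s1 \<le> r" "s2 \<le> r" using s1 s2 by (auto simp: r_def)
      define K where "K = (\<lambda>f :: complex \<Rightarrow> complex. L (\<lambda>z. f (of_real r * z)))"
      have K: "fock_compact p q K" unfolding K_def by (rule fock_compact_dilation[OF L p(1) r(1,2)])
      have "fock_op_norm p q (op_diff L K) \<le> ereal (2 * c1 * x1 + 2 * c2 * x2 + e)"
        unfolding fock_op_norm_def
      proof (rule SUP_least)
        fix f assume "f \<in> {f \<in> fock_space p. fock_norm p f \<le> 1}"
        then have f: "f \<in> fock_space p" "fock_norm p f \<le> 1" by auto
        define W1 where "W1 = weighted_comp \<psi>1 \<phi>1 (\<lambda>z. f z - f (of_real r * z))"
        define W2 where "W2 = weighted_comp \<psi>2 \<phi>2 (\<lambda>z. f z - f (of_real r * z))"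
        note W = s1(3)[OF r(3,2) f, folded W1_def] s2(3)[OF r(4,2) f, folded W2_def]
        have eq: "op_diff L K f z = W1 z - W2 z" for z
          by (simp add: op_diff_def L_def K_def W1_def W2_def weighted_comp_def algebra_simps)
        then have eq': "op_diff L K f = (\<lambda>z. W1 z - W2 z)" by auto
        have "fock_norm q (op_diff L K f) \<le> fock_norm q W1 + fock_norm q W2"
          unfolding eq' using W
          by (intro fock_norm_triangle(2) holomorphic_on_diff q norm_triangle_ineq4) (blast intro: fock_spaceD)+
        also have "\<dots> \<le> (c1 * (x1 + d) * 2 + d) + (c2 * (x2 + d) * 2 + d)"
          using W by (intro add_mono) auto
        also have "\<dots> = 2 * c1 * x1 + 2 * c2 * x2 + (2 * c1 * d + 2 * c2 * d + 2 * d)"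
          by (simp add: algebra_simps)
        finally show "ereal (fock_norm q (op_diff L K f)) \<le> ereal (2 * c1 * x1 + 2 * c2 * x2 + e)"
          by (simp add: de)
      qed
      moreover have "fock_ess_norm p q L \<le> fock_op_norm p q (op_diff L K)"
        unfolding fock_ess_norm_def using K by (intro INF_lower) simp
      ultimately show "fock_ess_norm p q L \<le> ereal (2 * c1) * X1 + ereal (2 * c2) * X2 + ereal e"
        by (simp add: x1 x2)
    qed
  qed
  then show ?thesis by (simp add: c1_def c2_def X1_def X2_def)
qed

theorem theorem1p6:
  fixes p q :: real
    and \<psi>1 \<psi>2 \<phi>1 \<phi>2 :: "complex \<Rightarrow> complex"
    and a1 a2 b1 b2 :: complex
  assumes "1 < p" and "p \<le> q"
    and "\<psi>1 holomorphic_on UNIV" and "\<psi>2 holomorphic_on UNIV"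
    and "\<phi>1 holomorphic_on UNIV" and "\<phi>2 holomorphic_on UNIV"
    and "\<psi>1 \<noteq> (\<lambda>z. 0)" and "\<psi>2 \<noteq> (\<lambda>z. 0)" and "\<phi>1 \<noteq> \<phi>2"
    and "fock_bounded_linear p q (op_diff (weighted_comp \<psi>1 \<phi>1) (weighted_comp \<psi>2 \<phi>2))"
    and "\<And>z. \<phi>1 z = a1 * z + b1" and "\<And>z. \<phi>2 z = a2 * z + b2"
    and "0 < norm a1" and "norm a1 \<le> 1" and "0 < norm a2" and "norm a2 \<le> 1"
  shows "ereal (alpha a1 b1 a2 b2) *
           Limsup at_infinity (\<lambda>z. ereal (m_fun \<psi>1 \<phi>1 z + m_fun \<psi>2 \<phi>2 z))
         \<le> fock_ess_norm p q (op_diff (weighted_comp \<psi>1 \<phi>1) (weighted_comp \<psi>2 \<phi>2))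
       \<and> fock_ess_norm p q (op_diff (weighted_comp \<psi>1 \<phi>1) (weighted_comp \<psi>2 \<phi>2))
         \<le> ereal (2 * (q / (p * (norm a1)\<^sup>2)) powr (1 / q)) *
             Limsup at_infinity (\<lambda>z. ereal (m_fun \<psi>1 \<phi>1 z))
         + ereal (2 * (q / (p * (norm a2)\<^sup>2)) powr (1 / q)) *
             Limsup at_infinity (\<lambda>z. ereal (m_fun \<psi>2 \<phi>2 z))"
proof (intro conjI essential_norm_lower_bound essential_norm_upper_bound)
  \<comment> \<open>Distinct affine symbols differ in a coefficient; this makes \<open>alpha\<close>
    positive, as the division in the lower bound requires.\<close>
  show "a1 \<noteq> a2 \<or> b1 \<noteq> b2"
    using \<open>\<phi>1 \<noteq> \<phi>2\<close> assms(11,12) by (metis ext)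
  show "fock_linear p q (op_diff (weighted_comp \<psi>1 \<phi>1) (weighted_comp \<psi>2 \<phi>2))"
    using assms(10) by (simp add: fock_bounded_linear_def)
qed (use assms in auto)

end
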